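(* The maximum cardinality of an affine equiangular set with norm $3$ with respect to the switching root $\rho$ in $L$ is $57$. Moreover, for every such maximum affine equiangular set $\omega$ in $L$, there exist a unique Latin square $S=(S_{ij})_{i,j\in[6]}$ of order $6$ (with symbols $1,\dots,6$) and unique cliques $C_1,C_2,C_3$ of size $7$ in the distance $2$-or-$3$ graph of the cartesian product of $J(6,3)$ and $K_2$ such that $\omega$ is switching equivalent to $\omega_0\cup\omega_1\cup\omega_2\cup\omega_3$, where $$\omega_0=\{x_{i,j,S_{ij}} : i,j\in[6]\}$$ and $$\omega_i=\{x^{(i)}_{I,\varepsilon,1} : (I,\varepsilon)\in C_i\}\qquad (i=1,2,3).$$
   Context: Notation: $[n]=\{1,\dots,n\}$; $\binom{[n]}{k}$ is the set of $k$-subsets of $[n]$; $(u,v)$ is the standard inner product. Lattices. $A_n=\{x\in\mathbb{Z}^{n+1}: x_1+\cdots+x_{n+1}=0\}$ and $\alpha_n=(\frac1{n+1},\dots,\frac1{n+1},-\frac n{n+1})\in\mathbb{R}^{n+1}$ (so $\alpha_1=(\frac12,-\frac12)$). Let $\Lambda=A_5^3\oplus A_1^4\subset\mathbb{R}^{26}$; vectors of $\mathbb{R}^{26}$ are written $(v_1,\dots,v_7)$ with $v_1,v_2,v_3\in\mathbb{R}^6$ and $v_4,\dots,v_7\in\mathbb{R}^2$. Let $\beta_0=(\alpha_5,\alpha_5,\alpha_5,0,0,0,\alpha_1)$, $\beta_1=(3\alpha_5,0,0,0,\alpha_1,\alpha_1,\alpha_1)$, $\beta_2=(0,3\alpha_5,0,\alpha_1,0,\alpha_1,\alpha_1)$,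 $\beta_3=(0,0,3\alpha_5,\alpha_1,\alpha_1,0,\alpha_1)$. $L$ is the lattice generated by $\Lambda$ and $\beta_0,\beta_1,\beta_2,\beta_3$ (an integral lattice). Let $\rho=(0,0,0,0,0,0,2\alpha_1)$. Affine equiangular sets. A set $\omega$ of vectors is an affine equiangular set with norm $3$ with respect to the switching root $\rho$ if $(u,\rho)=1$ and $(u,u)=3$ for all $u\in\omega$, and $(u,v)\in\{0,1\}$ for all distinct $u,v\in\omega$. It is an affine equiangular set in $L$ if $\omega\subset L$, and it is maximum in $L$ if no such set in $L$ has larger cardinality. Two such sets $\omega,\omega'$ are switching equivalent if there is a bijection $g:\omega\to\omega'$ with $g(u)\in\{u,\rho-u\}$ for every $u\in\omega$. Vectors. With $e_1,\dots,e_6$ the standard basis of $\mathbb{R}^6$, let $\alpha_5^{(i)}=\frac16(1,1,1,1,1,1)-e_i$ for $i\in[6]$ and $\alpha_I=\frac12\big(\sum_{i\in[6]\setminus I}e_i-\sum_{i\in I}e_i\big)$ for $I\in\binom{[6]}3$. For $i_1,i_2,i_3\in[6]$, $x_{i_1,i_2,i_3}=(\alpha_5^{(i_1)},\alpha_5^{(i_2)},\alpha_5^{(i_3)},0,0,0,\alpha_1)$. For $I\in\binom{[6]}3$ and $\varepsilon_1,\varepsilon_2\in\{\pm1\}$, $x^{(1)}_{I,\varepsilon_1,\varepsilon_2}=(\alpha_I,0,0,0,\varepsilon_1\alpha_1,\varepsilon_2\alpha_1,\alpha_1)$, $x^{(2)}_{I,\varepsilon_1,\varepsilon_2}=(0,\alpha_I,0,\varepsilon_2\alpha_1,0,\varepsilon_1\alpha_1,\alpha_1)$,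 $x^{(3)}_{I,\varepsilon_1,\varepsilon_2}=(0,0,\alpha_I,\varepsilon_1\alpha_1,\varepsilon_2\alpha_1,0,\alpha_1)$. Graphs. The Johnson graph $J(6,3)$ has vertex set $\binom{[6]}3$, with two vertices adjacent iff they intersect in exactly $2$ elements. $K_2$ is the complete graph on $\{\pm1\}$. In the cartesian product of graphs $G$ and $H$ (vertex set $V(G)\times V(H)$), $(u,v)$ and $(u',v')$ are adjacent iff ($u=u'$ and $v\sim v'$) or ($v=v'$ and $u\sim u'$). The distance $2$-or-$3$ graph of a connected graph $G$ has the same vertices as $G$, two being adjacent iff their distance in $G$ is $2$ or $3$. *)

theory Defs
  imports
    "HOL-Analysis.Analysis"
    "HOL-Computational_Algebra.Group_Closure"
begin

text \<open>
  The numeral types \<open>6\<close> and \<open>2\<close> serve as the index sets $\{1,\dots,6\}$ and $\{1,2\}$. They are the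
  residues modulo 6 and 2, so the numerals \<open>1\<close>, ..., \<open>6\<close> denote their elements exactly once each
  (with \<open>6 = 0\<close>), and likewise \<open>1\<close>, \<open>2\<close>. The last coordinate of a vector \<open>v\<close> of the
  6-dimensional space is thus \<open>v $ 6\<close>.

  The inner product of a product type is the sum of the inner products of the components, so the
  following type is the Euclidean space of dimension 26, with vectors written in seven blocks.
\<close>

type_synonym vec26 =
  "(real^6) \<times> (real^6) \<times> (real^6) \<times> (real^2) \<times> (real^2) \<times> (real^2) \<times> (real^2)"

text \<open>The root lattice $A_n$, where \<open>CARD('n)\<close> is $n + 1$.\<close>

definition lattice_A :: "(real^'n) set" where
  "lattice_A = {x. (\<forall>i. x $ i \<in> \<int>) \<and> (\<Sum>i\<in>UNIV. x $ i) = 0}"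

definition alpha5 :: "real^6" where
  "alpha5 = (\<chi> i. if i = 6 then - (5/6) else 1/6)"

definition alpha1 :: "real^2" where
  "alpha1 = (\<chi> i. if i = 2 then - (1/2) else 1/2)"

definition Lambda :: "vec26 set" where
  "Lambda = lattice_A \<times> lattice_A \<times> lattice_A \<times> lattice_A \<times> lattice_A \<times> lattice_A \<times> lattice_A"

definition beta0 :: vec26 where
  "beta0 = (alpha5, alpha5, alpha5, 0, 0, 0, alpha1)"

definition beta1 :: vec26 where
  "beta1 = (3 *\<^sub>R alpha5, 0, 0, 0, alpha1, alpha1, alpha1)"

definition beta2 :: vec26 where
  "beta2 = (0, 3 *\<^sub>R alpha5, 0, alpha1, 0, alpha1, alpha1)"

definition beta3 :: vec26 where
  "beta3 = (0, 0, 3 *\<^sub>R alpha5, alpha1, alpha1, 0, alpha1)"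

definition lattice_L :: "vec26 set" where
  "lattice_L = group_closure (Lambda \<union> {beta0, beta1, beta2, beta3})"

definition rho :: vec26 where
  "rho = (0, 0, 0, 0, 0, 0, 2 *\<^sub>R alpha1)"

definition affine_equiangular3 :: "'a::real_inner \<Rightarrow> 'a set \<Rightarrow> bool" where
  "affine_equiangular3 r \<omega> \<longleftrightarrow>
     (\<forall>u\<in>\<omega>. u \<bullet> r = 1 \<and> u \<bullet> u = 3) \<and>
     (\<forall>u\<in>\<omega>. \<forall>v\<in>\<omega>. u \<noteq> v \<longrightarrow> u \<bullet> v \<in> {0, 1})"

definition affine_equiangular3_in :: "'a::real_inner set \<Rightarrow> 'a \<Rightarrow> 'a set \<Rightarrow> bool" where
  "affine_equiangular3_in M r \<omega> \<longleftrightarrow> affine_equiangular3 r \<omega> \<and> \<omega> \<subseteq> M"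

text \<open>
  Cardinalities are compared by \<open>\<prec>\<close> rather than \<open>card\<close>, since \<open>card\<close> of an infinite set is \<open>0\<close>.
\<close>

definition maximum_affine_equiangular3_in :: "'a::real_inner set \<Rightarrow> 'a \<Rightarrow> 'a set \<Rightarrow> bool" where
  "maximum_affine_equiangular3_in M r \<omega> \<longleftrightarrow>
     affine_equiangular3_in M r \<omega> \<and> \<not> (\<exists>\<omega>'. affine_equiangular3_in M r \<omega>' \<and> \<omega> \<prec> \<omega>')"

definition switching_equivalent :: "'a::real_inner \<Rightarrow> 'a set \<Rightarrow> 'a set \<Rightarrow> bool" where
  "switching_equivalent r \<omega> \<omega>' \<longleftrightarrow> (\<exists>g. bij_betw g \<omega> \<omega>' \<and> (\<forall>u\<in>\<omega>. g u \<in> {u, r - u}))"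

definition alpha5_at :: "6 \<Rightarrow> real^6" where
  "alpha5_at i = (1/6) *\<^sub>R (\<chi> j. 1) - axis i 1"

definition alpha_set :: "6 set \<Rightarrow> real^6" where
  "alpha_set I = (1/2) *\<^sub>R ((\<Sum>i\<in>UNIV - I. axis i 1) - (\<Sum>i\<in>I. axis i 1))"

definition x0 :: "6 \<Rightarrow> 6 \<Rightarrow> 6 \<Rightarrow> vec26" where
  "x0 i j k = (alpha5_at i, alpha5_at j, alpha5_at k, 0, 0, 0, alpha1)"

definition x1 :: "6 set \<Rightarrow> int \<Rightarrow> int \<Rightarrow> vec26" where
  "x1 I e1 e2 =
     (alpha_set I, 0, 0, 0, of_int e1 *\<^sub>R alpha1, of_int e2 *\<^sub>R alpha1, alpha1)"

definition x2 :: "6 set \<Rightarrow> int \<Rightarrow> int \<Rightarrow> vec26" where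
  "x2 I e1 e2 =
     (0, alpha_set I, 0, of_int e2 *\<^sub>R alpha1, 0, of_int e1 *\<^sub>R alpha1, alpha1)"

definition x3 :: "6 set \<Rightarrow> int \<Rightarrow> int \<Rightarrow> vec26" where
  "x3 I e1 e2 =
     (0, 0, alpha_set I, of_int e1 *\<^sub>R alpha1, of_int e2 *\<^sub>R alpha1, 0, alpha1)"

text \<open>Each undirected edge is represented by both of its ordered pairs.\<close>

record 'a sgraph =
  vertices :: "'a set"
  edges :: "('a \<times> 'a) set"

definition johnson_6_3 :: "6 set sgraph" where
  "johnson_6_3 =
     \<lparr>vertices = {I. card I = 3},
      edges = {(I, J). card I = 3 \<and> card J = 3 \<and> card (I \<inter> J) = 2}\<rparr>"

definition complete_graph :: "'a set \<Rightarrow> 'a sgraph" where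
  "complete_graph V = \<lparr>vertices = V, edges = {(u, v). u \<in> V \<and> v \<in> V \<and> u \<noteq> v}\<rparr>"

definition cartesian_product :: "'a sgraph \<Rightarrow> 'b sgraph \<Rightarrow> ('a \<times> 'b) sgraph" where
  "cartesian_product G H =
     \<lparr>vertices = vertices G \<times> vertices H,
      edges = {((u, v), (u', v')).
        (u = u' \<and> u \<in> vertices G \<and> (v, v') \<in> edges H) \<or>
        (v = v' \<and> v \<in> vertices H \<and> (u, u') \<in> edges G)}\<rparr>"

text \<open>
  The length of a shortest walk; \<open>\<infinity>\<close> if there is none. \<open>edges G ^^ n\<close> relates the end points of the
  walks of length \<open>n\<close>.
\<close>

definition graph_dist :: "'a sgraph \<Rightarrow> 'a \<Rightarrow> 'a \<Rightarrow> enat" where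
  "graph_dist G u v = (INF n\<in>{n. (u, v) \<in> edges G ^^ n}. enat n)"

definition distance_2_or_3_graph :: "'a sgraph \<Rightarrow> 'a sgraph" where
  "distance_2_or_3_graph G =
     \<lparr>vertices = vertices G,
      edges = {(u, v). u \<in> vertices G \<and> v \<in> vertices G \<and> graph_dist G u v \<in> {2, 3}}\<rparr>"

definition clique :: "'a sgraph \<Rightarrow> 'a set \<Rightarrow> bool" where
  "clique G C \<longleftrightarrow> C \<subseteq> vertices G \<and> (\<forall>u\<in>C. \<forall>v\<in>C. u \<noteq> v \<longrightarrow> (u, v) \<in> edges G)"

definition clique_graph :: "(6 set \<times> int) sgraph" where
  "clique_graph = distance_2_or_3_graph (cartesian_product johnson_6_3 (complete_graph {1, - 1}))"

definition latin_square :: "(6 \<Rightarrow> 6 \<Rightarrow> 6) \<Rightarrow> bool" where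
  "latin_square S \<longleftrightarrow> (\<forall>i. bij (\<lambda>j. S i j)) \<and> (\<forall>j. bij (\<lambda>i. S i j))"

definition omega0 :: "(6 \<Rightarrow> 6 \<Rightarrow> 6) \<Rightarrow> vec26 set" where
  "omega0 S = {x0 i j (S i j) | i j. True}"

definition omega1 :: "(6 set \<times> int) set \<Rightarrow> vec26 set" where
  "omega1 C = {x1 I e 1 | I e. (I, e) \<in> C}"

definition omega2 :: "(6 set \<times> int) set \<Rightarrow> vec26 set" where
  "omega2 C = {x2 I e 1 | I e. (I, e) \<in> C}"

definition omega3 :: "(6 set \<times> int) set \<Rightarrow> vec26 set" where
  "omega3 C = {x3 I e 1 | I e. (I, e) \<in> C}"

end

theory Submission
  imports Defs
begin

text \<open>
  In each component, an element of the coset \<open>k \<alpha>\<^sub>n + A\<^sub>n\<close> has norm at least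
  \<open>r (n + 1 - r) / (n + 1)\<close> with \<open>r = k mod (n + 1)\<close>, with equality exactly for the vectors \<open>glue I\<close>
  with \<open>card I = r\<close>. For a coset of \<open>Lambda\<close> in \<open>lattice_L\<close> whose last
  component is odd, the sum of these bounds leaves no slack at norm 3, so every vector with norm 3 and inner product 1
  with \<open>rho\<close> is, up to switching, one of the \<open>x0\<close>, \<open>x1\<close>, \<open>x2\<close>, \<open>x3\<close>. Vectors from different families
  are always compatible, so a set of such vectors splits into a set of cells of a
  partial Latin square, at most 36, and three cliques, at most 7 each.

  A clique in the distance 2-or-3 graph consists of two layers of triples that pairwise share at most
  one point, hence of at most 4 triples each, and double counting excludes two layers of size 4.

  Uniqueness holds because \<open>u\<close> and \<open>rho - u\<close> have inner product \<open>-2\<close> while inner products of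
  representatives are at least \<open>-1\<close>: no pair contains two representatives.
\<close>

section \<open>Sparse families of triples\<close>

definition sparse_triples :: "'a set set \<Rightarrow> bool" where
  "sparse_triples F \<longleftrightarrow> (\<forall>I\<in>F. card I = 3) \<and> (\<forall>I\<in>F. \<forall>J\<in>F. I \<noteq> J \<longrightarrow> card (I \<inter> J) \<le> 1)"

text \<open>Written as a sum of products of indicators, so that double counts become exchanges of
  sums. On the diagonal it is the degree of a point.\<close>

definition codegree :: "'a set set \<Rightarrow> 'a \<Rightarrow> 'a \<Rightarrow> int" where
  "codegree F x y = (\<Sum>I\<in>F. of_bool (x \<in> I) * of_bool (y \<in> I))"

lemma codegree_eq_card:
  fixes F :: "'a::finite set set"
  shows "codegree F x y = int (card {I \<in> F. x \<in> I \<and> y \<in> I})"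
  by (simp add: codegree_def flip: of_bool_conj) (simp add: Int_def)

lemma codegree_sum:
  fixes F :: "'a::finite set set"
  shows "(\<Sum>y\<in>UNIV. codegree F x y) = (\<Sum>I\<in>F. of_bool (x \<in> I) * int (card I))"
  unfolding codegree_def
  by (subst sum.swap) (simp flip: sum_distrib_left)

text \<open>With \<open>x\<close> removed, the triples through \<open>x\<close> become disjoint
  pairs among the five other points.\<close>

lemma codegree_self_le_2:
  fixes F :: "'a::finite set set"
  assumes "CARD('a) = 6" and "sparse_triples F"
  shows "codegree F x x \<le> 2"
proof -
  define G where "G = {I \<in> F. x \<in> I}"
  have card2: "card (I - {x}) = 2" if "I \<in> G" for I
    using that assms(2) by (simp add: G_def sparse_triples_def)
  have disj: "(I - {x}) \<inter> (J - {x}) = {}" if "I \<in> G" "J \<in> G" "I \<noteq> J" for I J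
  proof -
    have "card (I \<inter> J) \<le> 1" "x \<in> I \<inter> J"
      using that assms(2) by (auto simp: G_def sparse_triples_def)
    then have "I \<inter> J = {x}"
      by (auto simp: card_le_Suc0_iff_eq)
    then show ?thesis by blast
  qed
  have "2 * card G = (\<Sum>I\<in>G. card (I - {x}))"
    by (simp add: card2)
  also have "\<dots> = card (\<Union>I\<in>G. I - {x})"
    using disj by (subst card_UN_disjoint) auto
  also have "\<dots> \<le> card (UNIV - {x})"
    by (intro card_mono) auto
  also have "\<dots> = 5"
    using assms(1) by simp
  finally show ?thesis
    by (simp add: codegree_eq_card G_def)
qed

lemma codegree_self_sum:
  fixes F :: "'a::finite set set"
  assumes "sparse_triples F"
  shows "(\<Sum>x\<in>UNIV. codegree F x x) = 3 * int (card F)"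
proof -
  have "(\<Sum>x\<in>UNIV. codegree F x x) = (\<Sum>I\<in>F. int (card I))"
    unfolding codegree_def by (subst sum.swap) (simp flip: of_bool_conj)
  also have "\<dots> = (\<Sum>I\<in>F. 3)"
    using assms by (intro sum.cong) (auto simp: sparse_triples_def)
  finally show ?thesis by simp
qed

text \<open>The degree sum is three times the number of triples and at most 6 * 2 = 12.\<close>

lemma sparse_triples_card_le_4:
  fixes F :: "'a::finite set set"
  assumes "CARD('a) = 6" and "sparse_triples F"
  shows "card F \<le> 4"
proof -
  have "3 * int (card F) \<le> (\<Sum>x\<in>(UNIV :: 'a set). 2)"
    unfolding codegree_self_sum[OF assms(2), symmetric]
    by (intro sum_mono codegree_self_le_2[OF assms])
  then show ?thesis by (simp add: assms(1))
qed

text \<open>Four triples use up the whole degree sum 12, so no point can have degree below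
  2.\<close>

lemma codegree_self_eq_2:
  fixes F :: "'a::finite set set"
  assumes "CARD('a) = 6" and "sparse_triples F" and "card F = 4"
  shows "codegree F x x = 2"
proof (rule ccontr)
  assume "codegree F x x \<noteq> 2"
  then have "codegree F x x < 2"
    using codegree_self_le_2[OF assms(1,2), of x] by linarith
  then have "(\<Sum>x\<in>UNIV. codegree F x x) < (\<Sum>x\<in>(UNIV :: 'a set). 2)"
    using codegree_self_le_2[OF assms(1,2)] by (intro sum_strict_mono_ex1) auto
  then show False
    by (simp add: codegree_self_sum[OF assms(2)] assms)
qed

lemma codegree_le_1:
  fixes F :: "'a::finite set set"
  assumes "sparse_triples F" and "x \<noteq> y"
  shows "codegree F x y \<le> 1"
proof -
  have "I = J" if "I \<in> F" "J \<in> F" "x \<in> I" "y \<in> I" "x \<in> J" "y \<in> J" for I J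
  proof (rule ccontr)
    assume "I \<noteq> J"
    then have "card (I \<inter> J) \<le> 1"
      using that assms(1) by (simp add: sparse_triples_def)
    moreover have "card {x, y} \<le> card (I \<inter> J)"
      using that by (intro card_mono) auto
    ultimately show False
      using assms(2) by simp
  qed
  then have "card {I \<in> F. x \<in> I \<and> y \<in> I} \<le> 1"
    by (auto simp: card_le_Suc0_iff_eq)
  then show ?thesis
    by (simp add: codegree_eq_card)
qed

text \<open>
  Count the pairs of points that are covered by both families. Each family covers all pairs except
  those of a perfect matching, so at least 15 - 6 = 9 pairs are covered by both. On the other hand,
  such a pair determines \<open>(I, J)\<close> with \<open>card (I \<inter> J) = 2\<close>, and there are only 8 of these, since the
  16 intersection numbers sum to 24. The proof sums over ordered pairs, including the diagonal.
\<close>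

lemma no_two_sparse_quadruples:
  fixes A B :: "'a::finite set set"
  assumes six: "CARD('a) = 6"
    and A: "sparse_triples A" "card A = 4" and B: "sparse_triples B" "card B = 4"
    and cross: "\<And>I J. I \<in> A \<Longrightarrow> J \<in> B \<Longrightarrow> card (I \<inter> J) \<in> {1, 2}"
  shows False
proof -
  define c where "c I J = int (card (I \<inter> J))" for I J :: "'a set"
  have c_sum: "c I J = (\<Sum>x\<in>UNIV. of_bool (x \<in> I) * of_bool (x \<in> J))" for I J
    by (simp add: c_def flip: of_bool_conj) (simp add: Int_def)
  have self: "codegree A x x * codegree B x x = 4" for x
    by (simp add: codegree_self_eq_2 six A B)
  have total: "(\<Sum>x\<in>UNIV. \<Sum>y\<in>UNIV. codegree F x y) = 36"
    if "sparse_triples F" "card F = 4" for F :: "'a set set"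
  proof -
    have "(\<Sum>x\<in>UNIV. \<Sum>y\<in>UNIV. codegree F x y) = (\<Sum>I\<in>F. int (card I) * int (card I))"
      unfolding codegree_sum by (subst sum.swap) (simp flip: sum_distrib_right)
    also have "\<dots> = (\<Sum>I\<in>F. 9)"
      using that by (intro sum.cong) (auto simp: sparse_triples_def)
    finally show ?thesis by (simp add: that)
  qed
  have sum_c: "(\<Sum>I\<in>A. \<Sum>J\<in>B. c I J) = 24"
  proof -
    have "(\<Sum>I\<in>A. \<Sum>J\<in>B. c I J) =
        (\<Sum>I\<in>A. \<Sum>x\<in>UNIV. \<Sum>J\<in>B. of_bool (x \<in> I) * of_bool (x \<in> J))"
      unfolding c_sum by (intro sum.cong refl sum.swap)
    also have "\<dots> = (\<Sum>x\<in>UNIV. \<Sum>I\<in>A. \<Sum>J\<in>B. of_bool (x \<in> I) * of_bool (x \<in> J))"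
      by (rule sum.swap)
    also have "\<dots> = (\<Sum>x\<in>UNIV. codegree A x x * codegree B x x)"
      unfolding codegree_def sum_product by (simp flip: of_bool_conj)
    finally show ?thesis by (simp add: self six)
  qed
  have sum_c2: "(\<Sum>I\<in>A. \<Sum>J\<in>B. c I J * c I J) =
      (\<Sum>x\<in>UNIV. \<Sum>y\<in>UNIV. codegree A x y * codegree B x y)"
  proof -
    \<comment> \<open>The square of \<open>c I J\<close> counts the ordered pairs of points in both
      \<open>I\<close> and \<open>J\<close>; \<open>t\<close> is the indicator of such a
      pair.\<close>
    define t :: "'a set \<Rightarrow> 'a set \<Rightarrow> 'a \<times> 'a \<Rightarrow> int" where
      "t I J p = of_bool (fst p \<in> I) * of_bool (snd p \<in> I) * (of_bool (fst p \<in> J) * of_bool (snd p \<in> J))"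
      for I J p
    have "(\<Sum>I\<in>A. \<Sum>J\<in>B. c I J * c I J) = (\<Sum>I\<in>A. \<Sum>J\<in>B. \<Sum>p\<in>UNIV. t I J p)"
      unfolding c_sum sum_product sum.cartesian_product UNIV_Times_UNIV
      by (intro sum.cong refl) (simp add: t_def case_prod_beta mult_ac)
    also have "\<dots> = (\<Sum>I\<in>A. \<Sum>p\<in>UNIV. \<Sum>J\<in>B. t I J p)"
      by (intro sum.cong refl sum.swap)
    also have "\<dots> = (\<Sum>p\<in>UNIV. \<Sum>I\<in>A. \<Sum>J\<in>B. t I J p)"
      by (rule sum.swap)
    also have "\<dots> = (\<Sum>x\<in>UNIV. \<Sum>y\<in>UNIV. codegree A x y * codegree B x y)"
      unfolding sum.cartesian_product[of "\<lambda>x y. codegree A x y * codegree B x y" UNIV UNIV]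
        UNIV_Times_UNIV
      by (intro sum.cong refl) (simp only: codegree_def t_def case_prod_beta sum_product)
    finally show ?thesis .
  qed
  \<comment> \<open>The numbers 1 and 2 are the roots of c * c = 3 * c - 2, so the sum of squares is
    3 * 24 - 2 * 16 = 40.\<close>
  have "(\<Sum>I\<in>A. \<Sum>J\<in>B. c I J * c I J) = (\<Sum>I\<in>A. \<Sum>J\<in>B. 3 * c I J - 2)"
    using cross by (intro sum.cong) (force simp: c_def)+
  also have "\<dots> = 40"
    by (simp add: sum_subtractf sum_c A B flip: sum_distrib_left)
  finally have "(\<Sum>x\<in>UNIV. \<Sum>y\<in>UNIV. codegree A x y * codegree B x y) = 40"
    by (simp add: sum_c2)
  \<comment> \<open>The term \<open>of_bool (x = y)\<close> makes the bound exact on the diagonal,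
    where it reads 2 + 2 - 1 + 1 = 4. The left side sums to 36 + 36 - 36 + 6 = 42 > 40.\<close>
  moreover have "(\<Sum>x\<in>(UNIV::'a set). \<Sum>y\<in>UNIV. codegree A x y + codegree B x y - 1 + of_bool (x = y)) \<le>
      (\<Sum>x\<in>UNIV. \<Sum>y\<in>UNIV. codegree A x y * codegree B x y)"
  proof (intro sum_mono)
    fix x y :: 'a
    show "codegree A x y + codegree B x y - 1 + of_bool (x = y) \<le> codegree A x y * codegree B x y"
    proof (cases "x = y")
      case True
      then show ?thesis
        using codegree_self_eq_2[OF six A, of x] codegree_self_eq_2[OF six B, of x] by simp
    next
      case False
      have "0 \<le> (1 - codegree A x y) * (1 - codegree B x y)"
        using codegree_le_1[OF A(1) False] codegree_le_1[OF B(1) False] by simp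
      then show ?thesis
        using False by (simp add: algebra_simps)
    qed
  qed
  moreover have "(\<Sum>x\<in>(UNIV::'a set). \<Sum>y\<in>UNIV. codegree A x y + codegree B x y - 1 + of_bool (x = y)) = 42"
    using total[OF A] total[OF B] by (simp add: sum.distrib sum_subtractf six)
  ultimately show False by linarith
qed

section \<open>Cliques of the distance 2-or-3 graph\<close>

abbreviation "cube_graph \<equiv> cartesian_product johnson_6_3 (complete_graph {1, - 1 :: int})"

abbreviation triples :: "(6 set \<times> int) set" where
  "triples \<equiv> {I. card I = 3} \<times> {1, - 1}"

text \<open>Closed form of the distance in \<open>cube_graph\<close>: the distance in J(6,3) plus
  the distance in K_2. On \<open>triples\<close> the subtraction is never truncated.\<close>

definition triple_dist :: "6 set \<times> int \<Rightarrow> 6 set \<times> int \<Rightarrow> nat" where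
  "triple_dist p q = 3 - card (fst p \<inter> fst q) + of_bool (snd p \<noteq> snd q)"

section \<open>Distances in the cartesian product of J(6,3) and K_2\<close>

lemma card_inter_le_3:
  fixes I J :: "'a::finite set"
  assumes "card I = 3"
  shows "card (I \<inter> J) \<le> 3"
  using assms by (metis card_mono finite inf_le1)

lemma card_inter_eq_3_iff:
  fixes I J :: "'a::finite set"
  assumes "card I = 3" "card J = 3"
  shows "card (I \<inter> J) = 3 \<longleftrightarrow> I = J"
  using assms by (metis card_subset_eq finite inf.idem inf_le1 inf_le2)

text \<open>Only one point of \<open>J\<close> lies outside \<open>I\<close>, so replacing
  \<open>I\<close> by \<open>J\<close> gains at most one common point with \<open>K\<close>.\<close>

lemma johnson_step:
  fixes I J K :: "'a::finite set"
  assumes "card J = 3" "card (I \<inter> J) = 2"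
  shows "card (J \<inter> K) \<le> card (I \<inter> K) + 1"
proof -
  have "card (J - I) = 1"
    using assms card_Diff_subset_Int[of J I] by (simp add: Int_commute)
  moreover have "J \<inter> K \<subseteq> (I \<inter> K) \<union> (J - I)"
    by blast
  then have "card (J \<inter> K) \<le> card ((I \<inter> K) \<union> (J - I))"
    by (intro card_mono) auto
  moreover have "card ((I \<inter> K) \<union> (J - I)) \<le> card (I \<inter> K) + card (J - I)"
    by (rule card_Un_le)
  ultimately show ?thesis by linarith
qed

text \<open>An edge changes either the sign or, by one exchange, the triple. Iterated along a walk,
  this bounds its length from below.\<close>

lemma triple_dist_step:
  assumes "(p, q) \<in> edges cube_graph" and "r \<in> triples"
  shows "triple_dist p r \<le> Suc (triple_dist q r)"
proof -
  obtain I e J d K f where pqr: "p = (I, e)" "q = (J, d)" "r = (K, f)"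
    by (metis surj_pair)
  show ?thesis
    using assms johnson_step[of J I K]
    by (auto simp: pqr triple_dist_def cartesian_product_def complete_graph_def johnson_6_3_def)
qed

lemma triple_dist_le_walk:
  assumes "(p, q) \<in> edges cube_graph ^^ n" and "q \<in> triples"
  shows "triple_dist p q \<le> n"
  using assms(1)
proof (induction n arbitrary: p)
  case 0
  then show ?case
    using assms(2) by (auto simp: triple_dist_def)
next
  case (Suc n)
  then obtain r where "(p, r) \<in> edges cube_graph" "(r, q) \<in> edges cube_graph ^^ n"
    by (meson relpow_Suc_E2)
  then show ?case
    using triple_dist_step[of p r q] Suc.IH[of r] assms(2) by simp
qed

text \<open>Some neighbour of \<open>p\<close> is one step closer to \<open>q\<close>: flip the sign
  if the triples agree, otherwise exchange a point of \<open>I - J\<close> for a point of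
  \<open>J - I\<close>.\<close>

lemma walk_of_triple_dist:
  assumes "p \<in> triples" and "q \<in> triples"
  shows "(p, q) \<in> edges cube_graph ^^ triple_dist p q"
  using assms(1)
proof (induction "triple_dist p q" arbitrary: p)
  case 0
  obtain I e J d where pq: "p = (I, e)" "q = (J, d)"
    by (metis surj_pair)
  have "card I = 3" "card J = 3"
    using 0 assms(2) by (auto simp: pq)
  moreover have "card (I \<inter> J) \<ge> 3" "e = d"
    using 0(1) by (auto simp: pq triple_dist_def)
  ultimately have "p = q"
    using card_inter_le_3[of I J] card_inter_eq_3_iff[of I J] by (simp add: pq)
  then show ?case
    using 0(1) by simp
next
  case (Suc n)
  obtain I e J d where pq: "p = (I, e)" "q = (J, d)"
    by (metis surj_pair)
  have IJ: "card I = 3" "card J = 3" "e \<in> {1, - 1}" "d \<in> {1, - 1}"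
    using Suc.prems assms(2) by (auto simp: pq)
  have "\<exists>r. r \<in> triples \<and> (p, r) \<in> edges cube_graph \<and> triple_dist r q = n"
  proof (cases "I = J")
    case True
    with Suc(2) have "e \<noteq> d" "n = 0"
      using IJ by (auto simp: triple_dist_def pq split: if_splits)
    then show ?thesis
      using IJ True
      by (intro exI[of _ q])
        (auto simp: pq triple_dist_def cartesian_product_def complete_graph_def johnson_6_3_def)
  next
    case False
    then have "\<not> I \<subseteq> J" "\<not> J \<subseteq> I"
      using IJ by (metis card_subset_eq finite)+
    then obtain x y where xy: "x \<in> I" "x \<notin> J" "y \<in> J" "y \<notin> I"
      by blast
    define K where "K = insert y (I - {x})"
    have "card K = 3" "I \<inter> K = I - {x}" "K \<inter> J = insert y (I \<inter> J)"
      using xy IJ by (auto simp: K_def)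
    then have "card K = 3" "card (I \<inter> K) = 2" "card (K \<inter> J) = Suc (card (I \<inter> J))"
      using xy IJ by simp_all
    moreover have "card (K \<inter> J) \<le> 3"
      using \<open>card K = 3\<close> by (rule card_inter_le_3)
    ultimately show ?thesis
      using IJ Suc(2)
      by (intro exI[of _ "(K, e)"])
        (auto simp: pq triple_dist_def cartesian_product_def complete_graph_def johnson_6_3_def)
  qed
  then obtain r where r: "r \<in> triples" "(p, r) \<in> edges cube_graph" "triple_dist r q = n"
    by blast
  with Suc(1)[of r] have "(r, q) \<in> edges cube_graph ^^ n"
    by simp
  with r(2) have "(p, q) \<in> edges cube_graph ^^ Suc n"
    by (rule relpow_Suc_I2)
  then show ?case
    by (simp add: Suc(2))
qed

lemma graph_dist_cube_graph:
  assumes "p \<in> triples" and "q \<in> triples"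
  shows "graph_dist cube_graph p q = enat (triple_dist p q)"
  unfolding graph_dist_def
proof (rule antisym)
  show "(INF n\<in>{n. (p, q) \<in> edges cube_graph ^^ n}. enat n) \<le> enat (triple_dist p q)"
    by (rule INF_lower) (simp add: walk_of_triple_dist assms)
  show "enat (triple_dist p q) \<le> (INF n\<in>{n. (p, q) \<in> edges cube_graph ^^ n}. enat n)"
    by (rule INF_greatest) (simp add: triple_dist_le_walk assms)
qed

lemma vertices_clique_graph: "vertices clique_graph = triples"
  by (simp add: clique_graph_def distance_2_or_3_graph_def cartesian_product_def
      johnson_6_3_def complete_graph_def)

text \<open>With c common points the distance is 3 - c for equal signs and 4 - c for different
  signs; it has to be 2 or 3.\<close>

lemma edges_clique_graph:
  assumes "(I, e) \<in> triples" and "(J, d) \<in> triples"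
  shows "((I, e), (J, d)) \<in> edges clique_graph \<longleftrightarrow>
    card (I \<inter> J) \<in> (if e = d then {0, 1} else {1, 2})"
proof -
  have "((I, e), (J, d)) \<in> edges clique_graph \<longleftrightarrow> triple_dist (I, e) (J, d) \<in> {2, 3}"
    using assms vertices_clique_graph
    by (auto simp: clique_graph_def distance_2_or_3_graph_def graph_dist_cube_graph
        numeral_eq_enat)
  also have "\<dots> \<longleftrightarrow> card (I \<inter> J) \<in> (if e = d then {0, 1} else {1, 2})"
  proof -
    define c where "c = card (I \<inter> J)"
    have "c \<le> 3"
      using card_inter_le_3[of I J] assms by (simp add: c_def)
    moreover have "triple_dist (I, e) (J, d) = 3 - c + of_bool (e \<noteq> d)"
      by (simp add: triple_dist_def c_def)
    ultimately show ?thesis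
      unfolding c_def[symmetric] by (cases "e = d") auto
  qed
  finally show ?thesis .
qed

section \<open>Cliques as two layers of triples\<close>

lemma clique_layer_sparse:
  assumes "clique clique_graph C" and "e \<in> {1, - 1}"
  shows "sparse_triples {I. (I, e) \<in> C}"
  unfolding sparse_triples_def
proof (intro conjI ballI impI)
  have C: "C \<subseteq> triples"
    using assms(1) by (simp add: clique_def vertices_clique_graph)
  show "card I = 3" if "I \<in> {I. (I, e) \<in> C}" for I
    using that C by auto
  show "card (I \<inter> J) \<le> 1" if IJ: "I \<in> {I. (I, e) \<in> C}" "J \<in> {I. (I, e) \<in> C}" "I \<noteq> J" for I J
  proof -
    have "((I, e), (J, e)) \<in> edges clique_graph"
      using assms(1) IJ by (auto simp: clique_def)
    moreover have "(I, e) \<in> triples" "(J, e) \<in> triples"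
      using IJ C by auto
    ultimately show ?thesis
      using edges_clique_graph[of I e J e] by auto
  qed
qed

lemma clique_card_le_7:
  assumes "clique clique_graph C"
  shows "card C \<le> 7"
proof (rule ccontr)
  assume "\<not> card C \<le> 7"
  define A where "A e = {I. (I, e) \<in> C}" for e :: int
  have C: "C \<subseteq> triples"
    using assms by (simp add: clique_def vertices_clique_graph)
  have sparse: "sparse_triples (A 1)" "sparse_triples (A (- 1))"
    using clique_layer_sparse[OF assms] by (auto simp: A_def)
  have "C = A 1 \<times> {1} \<union> A (- 1) \<times> {- 1}"
    using C by (auto simp: A_def)
  then have "card C = card (A 1) + card (A (- 1))"
    by (simp, subst card_Un_disjoint) auto
  then have four: "card (A 1) = 4" "card (A (- 1)) = 4"
    using sparse[THEN sparse_triples_card_le_4[rotated]] \<open>\<not> card C \<le> 7\<close> by auto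
  have "card (I \<inter> J) \<in> {1, 2}" if "I \<in> A 1" "J \<in> A (- 1)" for I J
  proof -
    have "((I, 1), (J, - 1)) \<in> edges clique_graph"
      using assms that by (auto simp: clique_def A_def)
    moreover have "(I, 1) \<in> triples" "(J, - 1) \<in> triples"
      using that C by (auto simp: A_def)
    ultimately show ?thesis
      using edges_clique_graph[of I 1 J "- 1"] by simp
  qed
  then show False
    using no_two_sparse_quadruples[OF _ sparse(1) four(1) sparse(2) four(2)] by simp
qed

lemma clique_of_card_7_exists: "\<exists>C. clique clique_graph C \<and> card C = 7"
proof -
  \<comment> \<open>The positive layer is a Pasch configuration, which covers every pair of points
    except {1,6}, {2,5} and {3,4}. Each negative triple contains one of these three pairs.\<close>
  define C :: "(6 set \<times> int) set" where
    "C = {({1,2,3}, 1), ({1,4,5}, 1), ({2,4,6}, 1), ({3,5,6}, 1),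
      ({1,2,6}, - 1), ({1,3,4}, - 1), ({2,4,5}, - 1)}"
  have sub: "C \<subseteq> triples"
    by (simp add: C_def)
  have "clique clique_graph C"
    unfolding clique_def vertices_clique_graph
  proof (intro conjI sub ballI impI)
    fix p q assume pq: "p \<in> C" "q \<in> C" "p \<noteq> q"
    have "card (fst p \<inter> fst q) \<in> (if snd p = snd q then {0, 1} else {1, 2})"
      using pq unfolding C_def by (elim insertE emptyE) (simp_all del: One_nat_def)
    then show "(p, q) \<in> edges clique_graph"
      using edges_clique_graph[of "fst p" "snd p" "fst q" "snd q"] pq(1,2)[THEN subsetD[OF sub]]
      by simp
  qed
  moreover have "card C = 7"
  proof -
    have "distinct [{1,2,3}, {1,4,5}, {2,4,6}, {3,5,6 :: 6}]" "distinct [{1,2,6}, {1,3,4}, {2,4,5 :: 6}]"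
      by (auto simp: set_eq_subset)
    then show ?thesis
      by (simp add: C_def)
  qed
  ultimately show ?thesis by blast
qed

section \<open>Minimal vectors of the cosets\<close>

text \<open>A single formula for \<open>0\<close>, \<open>alpha1\<close>, \<open>- alpha1\<close>,
  \<open>alpha5_at i\<close> and \<open>alpha_set I\<close>, so that one identity yields all inner
  products.\<close>

definition glue :: "'n::finite set \<Rightarrow> real^'n" where
  "glue I = (\<chi> i. real (card I) / real CARD('n) - of_bool (i \<in> I))"

lemma glue_empty [simp]: "glue {} = 0"
  by (simp add: glue_def vec_eq_iff)

lemma card_Compl:
  fixes I :: "'a::finite set"
  shows "card (- I) = CARD('a) - card I"
  by (simp add: Compl_eq_Diff_UNIV card_Diff_subset)

text \<open>Switching negates every block but the last, so on index sets it acts by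
  complementation.\<close>

lemma glue_Compl:
  fixes I :: "'n::finite set"
  shows "glue (- I) = - glue I"
proof -
  have "real (card (- I)) = real CARD('n) - real (card I)"
    by (simp add: card_Compl of_nat_diff card_mono)
  then show ?thesis
    by (auto simp: glue_def vec_eq_iff diff_divide_distrib)
qed

lemma inner_glue:
  fixes I J :: "'n::finite set"
  shows "glue I \<bullet> glue J = real (card (I \<inter> J)) - real (card I) * real (card J) / real CARD('n)"
proof -
  define a b where "a = real (card I) / real CARD('n)" and "b = real (card J) / real CARD('n)"
  have "glue I $ i * glue J $ i =
      a * b - a * of_bool (i \<in> J) - b * of_bool (i \<in> I) + of_bool (i \<in> I \<inter> J)" for i
    by (cases "i \<in> I"; cases "i \<in> J") (simp_all add: glue_def algebra_simps flip: a_def b_def)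
  moreover have "(\<Sum>i\<in>UNIV. of_bool (i \<in> K)) = real (card K)" for K :: "'n set"
    by simp
  ultimately have "glue I \<bullet> glue J =
      a * (real CARD('n) * b) - a * real (card J) - b * real (card I) + real (card (I \<inter> J))"
    unfolding inner_vec_def
    by (simp only: inner_real_def sum.distrib sum_subtractf sum_distrib_left[symmetric] sum_constant)
  then show ?thesis
    by (simp add: a_def b_def)
qed

text \<open>The coset \<open>k \<alpha>\<^sub>n + A\<^sub>n\<close> with n + 1 =
  \<open>CARD('n)\<close>: all coordinates of \<open>\<alpha>\<^sub>n\<close> are congruent to 1 /
  (n + 1) modulo 1. The index \<open>k\<close> may be any integer.\<close>

definition in_coset :: "int \<Rightarrow> real^'n \<Rightarrow> bool" where
  "in_coset k v \<longleftrightarrow> (\<forall>i. v $ i - of_int k / real CARD('n) \<in> \<int>) \<and> (\<Sum>i\<in>UNIV. v $ i) = 0"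

lemma in_coset_0: "in_coset 0 v \<longleftrightarrow> v \<in> lattice_A"
  by (simp add: in_coset_def lattice_A_def)

lemma in_coset_zero [simp]: "in_coset 0 0"
  by (simp add: in_coset_def)

text \<open>The index of the difference is given by a separate equation, so that the rule applies
  however that index is written.\<close>

lemma in_coset_diff:
  fixes v w :: "real^'n"
  assumes "in_coset k v" and "in_coset l w" and "k - l = m"
  shows "in_coset m (v - w)"
proof -
  have "v $ i - w $ i - of_int m / real CARD('n) =
      (v $ i - of_int k / real CARD('n)) - (w $ i - of_int l / real CARD('n))" for i
    by (simp add: assms(3)[symmetric] diff_divide_distrib)
  then show ?thesis
    using assms(1,2) unfolding in_coset_def
    by (simp only: vector_minus_component sum_subtractf Ints_diff) (simp add: sum_subtractf)
qed

lemma in_coset_glue: "in_coset (int (card I)) (glue I)"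
  by (simp add: in_coset_def glue_def sum_subtractf)

lemma in_coset_mod:
  fixes v :: "real^'n"
  assumes "in_coset k v"
  shows "in_coset (k mod int CARD('n)) v"
proof -
  have "v $ i - of_int (k mod int CARD('n)) / real CARD('n) =
      (v $ i - of_int k / real CARD('n)) + of_int (k div int CARD('n))" for i
    by (simp add: minus_div_mult_eq_mod[symmetric] diff_divide_distrib)
  then show ?thesis
    using assms unfolding in_coset_def by (simp only: Ints_add Ints_of_int) simp
qed

text \<open>With \<open>m i = v $ i - r / n\<close> an integer, sum the inequality \<open>0 \<le> m i * (m i + 1)\<close> over \<open>i\<close>.\<close>

lemma coset_norm:
  fixes v :: "real^'n"
  assumes "in_coset k v"
  defines "n \<equiv> int CARD('n)"
  defines "r \<equiv> k mod n"
  shows coset_norm_ge: "v \<bullet> v \<ge> of_int (r * (n - r)) / of_int n"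
    and coset_norm_eq: "v \<bullet> v = of_int (r * (n - r)) / of_int n \<Longrightarrow> \<exists>I. card I = nat r \<and> v = glue I"
proof -
  have n: "real_of_int n = real CARD('n)" "n > 0"
    by (simp_all add: n_def)
  have r: "0 \<le> r" "r < n"
    using n by (simp_all add: r_def)
  have "in_coset r v"
    using in_coset_mod[OF assms(1)] by (simp add: r_def n_def)
  then have "\<forall>i. \<exists>m. v $ i - of_int r / of_int n = of_int m"
    by (auto simp: in_coset_def n elim!: Ints_cases)
  then obtain m :: "'n \<Rightarrow> int" where m: "v $ i = of_int r / of_int n + of_int (m i)" for i
    by (metis add.commute diff_add_cancel)
  have sum_v: "(\<Sum>i\<in>UNIV. v $ i) = 0"
    using assms(1) by (simp add: in_coset_def)
  have sum_m: "(\<Sum>i\<in>UNIV. m i) = - r"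
  proof -
    have "real_of_int (r + (\<Sum>i\<in>UNIV. m i)) = 0"
      using sum_v n by (simp add: m sum.distrib)
    then show ?thesis by linarith
  qed
  have nonneg: "0 \<le> m i * (m i + 1)" for i
    by (cases "m i \<ge> 0") (auto intro: mult_nonpos_nonpos)
  \<comment> \<open>Each square is split so that its linear part depends only on the sum of
    \<open>m\<close>, known to be \<open>- r\<close>; what is left over is the nonnegative
    \<open>m i * (m i + 1)\<close>.\<close>
  have "v \<bullet> v = (\<Sum>i\<in>UNIV. of_int (m i * (m i + 1)) + (2 * of_int r / of_int n - 1) * of_int (m i)
      + (of_int r / of_int n)\<^sup>2)"
    unfolding inner_vec_def by (intro sum.cong refl) (simp add: m algebra_simps power2_eq_square)
  also have "\<dots> = of_int (\<Sum>i\<in>UNIV. m i * (m i + 1)) + (2 * of_int r / of_int n - 1) * of_int (\<Sum>i\<in>UNIV. m i)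
      + of_int n * (of_int r / of_int n)\<^sup>2"
    by (simp add: sum.distrib n flip: sum_distrib_left)
  also have "\<dots> = of_int (\<Sum>i\<in>UNIV. m i * (m i + 1)) + of_int (r * (n - r)) / of_int n"
    using n by (simp add: sum_m field_simps power2_eq_square)
  finally have norm: "v \<bullet> v = of_int (\<Sum>i\<in>UNIV. m i * (m i + 1)) + of_int (r * (n - r)) / of_int n" .
  have "0 \<le> (\<Sum>i\<in>UNIV. m i * (m i + 1))"
    by (intro sum_nonneg nonneg)
  then have "0 \<le> real_of_int (\<Sum>i\<in>UNIV. m i * (m i + 1))"
    by (simp only: of_int_0_le_iff)
  then show "v \<bullet> v \<ge> of_int (r * (n - r)) / of_int n"
    using norm by linarith
  assume "v \<bullet> v = of_int (r * (n - r)) / of_int n"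
  then have "real_of_int (\<Sum>i\<in>UNIV. m i * (m i + 1)) = 0"
    using norm by linarith
  then have "(\<Sum>i\<in>UNIV. m i * (m i + 1)) = 0"
    by (simp only: of_int_eq_0_iff)
  \<comment> \<open>In the case of equality every product of consecutive integers vanishes; the
    positions with \<open>m i = - 1\<close> form the index set.\<close>
  then have m_cases: "m i = 0 \<or> m i = - 1" for i
    using nonneg by (simp add: sum_nonneg_eq_0_iff eq_neg_iff_add_eq_0)
  define I where "I = {i. m i = - 1}"
  have m_eq: "m i = - of_bool (i \<in> I)" for i
    using m_cases[of i] by (auto simp: I_def)
  have "- r = (\<Sum>i\<in>UNIV. - of_bool (i \<in> I))"
    unfolding sum_m[symmetric] m_eq ..
  then have card: "r = int (card I)"
    by (simp add: sum_negf)
  have "v $ i = glue I $ i" for i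
    by (simp add: m m_eq glue_def card n)
  then have "v = glue I"
    by (simp add: vec_eq_iff)
  with card show "\<exists>I. card I = nat r \<and> v = glue I"
    by auto
qed

section \<open>The named vectors as glue vectors and their cosets\<close>

lemma alpha5_eq_glue: "alpha5 = glue {6}"
  by (simp add: alpha5_def glue_def vec_eq_iff)

lemma alpha1_eq_glue: "alpha1 = glue {2}"
  by (simp add: alpha1_def glue_def vec_eq_iff)

lemma alpha5_at_eq_glue: "alpha5_at i = glue {i}"
  by (simp add: alpha5_at_def glue_def vec_eq_iff axis_def)

lemma alpha_set_eq_glue:
  assumes "card I = 3"
  shows "alpha_set I = glue I"
proof -
  have "(\<Sum>i\<in>J. axis i (1::real)) $ j = of_bool (j \<in> J)" for J :: "6 set" and j
    by (simp add: axis_def)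
  then show ?thesis
    by (simp add: alpha_set_def glue_def vec_eq_iff assms)
qed

lemma minus_alpha1_eq_glue: "- alpha1 = glue {1}"
  by (simp add: alpha1_def glue_def vec_eq_iff forall_2)

lemma sign_alpha1_eq_glue:
  assumes "e \<in> {1, - 1}"
  shows "of_int e *\<^sub>R alpha1 = glue {if e = 1 then 2 else 1}"
  using assms minus_alpha1_eq_glue alpha1_eq_glue by auto

lemma in_coset_alpha:
  "in_coset 1 alpha5" "in_coset 3 (3 *\<^sub>R alpha5)" "in_coset 1 alpha1"
proof -
  show alpha5: "in_coset 1 alpha5" and "in_coset 1 alpha1"
    using in_coset_glue[of "{6 :: 6}"] in_coset_glue[of "{2 :: 2}"]
    by (simp_all add: alpha5_eq_glue alpha1_eq_glue)
  \<comment> \<open>This vector is not itself a glue vector: its last coordinate is -5/2, which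
    differs from 1/2 by the integer -3.\<close>
  have "(3 *\<^sub>R alpha5) $ i - of_int 3 / real CARD(6) = of_int (if i = 6 then - 3 else 0)" for i
    by (simp add: alpha5_def)
  moreover have "(\<Sum>i\<in>UNIV. (3 *\<^sub>R alpha5) $ i) = 3 * (\<Sum>i\<in>UNIV. alpha5 $ i)"
    by (simp add: sum_distrib_left)
  ultimately show "in_coset 3 (3 *\<^sub>R alpha5)"
    using alpha5 by (simp only: in_coset_def Ints_of_int mult_zero_right) simp
qed

text \<open>The numbers \<open>a0\<close>, ..., \<open>a3\<close> are the coefficients of the
  generators \<open>beta0\<close>, ..., \<open>beta3\<close> modulo \<open>Lambda\<close>. The index
  of each block is linear in them, hence compatible with the differences that generate the
  group.\<close>

lemma lattice_L_cosets:
  assumes "u \<in> lattice_L"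
  obtains a0 a1 a2 a3 v1 v2 v3 v4 v5 v6 v7 where
    "u = (v1, v2, v3, v4, v5, v6, v7)"
    "in_coset (a0 + 3 * a1) v1" "in_coset (a0 + 3 * a2) v2" "in_coset (a0 + 3 * a3) v3"
    "in_coset (a2 + a3) v4" "in_coset (a1 + a3) v5" "in_coset (a1 + a2) v6"
    "in_coset (a0 + a1 + a2 + a3) v7"
proof -
  define P :: "vec26 \<Rightarrow> int \<Rightarrow> int \<Rightarrow> int \<Rightarrow> int \<Rightarrow> bool" where
    "P = (\<lambda>(v1, v2, v3, v4, v5, v6, v7) a0 a1 a2 a3.
      in_coset (a0 + 3 * a1) v1 \<and> in_coset (a0 + 3 * a2) v2 \<and> in_coset (a0 + 3 * a3) v3 \<and>
      in_coset (a2 + a3) v4 \<and> in_coset (a1 + a3) v5 \<and> in_coset (a1 + a2) v6 \<and>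
      in_coset (a0 + a1 + a2 + a3) v7)"
  have "\<exists>a0 a1 a2 a3. P u a0 a1 a2 a3"
    using assms unfolding lattice_L_def
  proof induction
    case (base s)
    then consider "s = 0 \<or> s \<in> Lambda" | "s = beta0" | "s = beta1" | "s = beta2" | "s = beta3"
      by blast
    then show ?case
    proof cases
      case 1
      then have "P s 0 0 0 0"
        by (auto simp: P_def Lambda_def in_coset_0 zero_prod_def lattice_A_def)
      then show ?thesis by blast
    next
      case 2
      then have "P s 1 0 0 0"
        by (simp add: P_def beta0_def in_coset_alpha)
      then show ?thesis by blast
    next
      case 3
      then have "P s 0 1 0 0"
        by (simp add: P_def beta1_def in_coset_alpha)
      then show ?thesis by blast
    next
      case 4
      then have "P s 0 0 1 0"
        by (simp add: P_def beta2_def in_coset_alpha)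
      then show ?thesis by blast
    next
      case 5
      then have "P s 0 0 0 1"
        by (simp add: P_def beta3_def in_coset_alpha)
      then show ?thesis by blast
    qed
  next
    case (diff s t)
    then obtain a0 a1 a2 a3 b0 b1 b2 b3 where "P s a0 a1 a2 a3" "P t b0 b1 b2 b3"
      by blast
    then have "P (s - t) (a0 - b0) (a1 - b1) (a2 - b2) (a3 - b3)"
      unfolding P_def
      by (cases s; cases t) (auto elim!: in_coset_diff)
    then show ?case by blast
  qed
  with that show thesis
    by (cases u) (auto simp: P_def)
qed

text \<open>The bounded sum is six times the least norm of the first six blocks, and 15 = 6 * (3 -
  1/2) leaves room for the norm 1/2 of \<open>alpha1\<close>. Everything depends on
  \<open>a0\<close> modulo 6 and the other coefficients modulo 2, a finite check of 48
  cases.\<close>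

lemma min_norm_cosets:
  fixes a0 a1 a2 a3 :: int
  defines "k1 \<equiv> (a0 + 3 * a1) mod 6" and "k2 \<equiv> (a0 + 3 * a2) mod 6" and "k3 \<equiv> (a0 + 3 * a3) mod 6"
  defines "k4 \<equiv> (a2 + a3) mod 2" and "k5 \<equiv> (a1 + a3) mod 2" and "k6 \<equiv> (a1 + a2) mod 2"
  assumes "odd (a0 + a1 + a2 + a3)"
    and "k1 * (6 - k1) + k2 * (6 - k2) + k3 * (6 - k3) +
      3 * (k4 * (2 - k4)) + 3 * (k5 * (2 - k5)) + 3 * (k6 * (2 - k6)) \<le> 15"
  shows "(k1, k2, k3, k4, k5, k6) \<in>
    {(1, 1, 1, 0, 0, 0), (5, 5, 5, 0, 0, 0), (3, 0, 0, 0, 1, 1), (0, 3, 0, 1, 0, 1), (0, 0, 3, 1, 1, 0)}"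
proof -
  define c b1 b2 b3 where b: "c = a0 mod 6" "b1 = a1 mod 2" "b2 = a2 mod 2" "b3 = a3 mod 2"
  have range: "c \<in> {0, 1, 2, 3, 4, 5}" "b1 \<in> {0, 1}" "b2 \<in> {0, 1}" "b3 \<in> {0, 1}"
    unfolding b by auto
  have "(a0 + 3 * a) mod 6 = (c + 3 * (a mod 2)) mod 6" for a
    by (simp add: b mult_mod_right mod_simps)
  then have k: "k1 = (c + 3 * b1) mod 6" "k2 = (c + 3 * b2) mod 6" "k3 = (c + 3 * b3) mod 6"
    "k4 = (b2 + b3) mod 2" "k5 = (b1 + b3) mod 2" "k6 = (b1 + b2) mod 2"
    by (simp_all add: k1_def k2_def k3_def k4_def k5_def k6_def b mod_add_eq)
  have "odd (c + b1 + b2 + b3)"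
    using assms(7) unfolding b by presburger
  moreover have "c = 0 \<or> c = 1 \<or> c = 2 \<or> c = 3 \<or> c = 4 \<or> c = 5"
    "b1 = 0 \<or> b1 = 1" "b2 = 0 \<or> b2 = 1" "b3 = 0 \<or> b3 = 1"
    using range by simp_all
  ultimately show ?thesis
    using assms(8) unfolding k by (elim disjE; hypsubst_thin; simp)
qed

section \<open>Representatives up to switching\<close>

definition cell :: "6 \<times> 6 \<times> 6 \<Rightarrow> vec26" where
  "cell = (\<lambda>(i, j, k). x0 i j k)"

datatype block = B1 | B2 | B3

lemma UNIV_block: "UNIV = {B1, B2, B3}"
  using block.exhaust by blast

text \<open>The second sign is fixed to 1. Switching complements the triple and negates both signs,
  so exactly one member of each switching pair has this form.\<close>

primrec node :: "block \<Rightarrow> 6 set \<times> int \<Rightarrow> vec26" where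
  "node B1 p = x1 (fst p) (snd p) 1"
| "node B2 p = x2 (fst p) (snd p) 1"
| "node B3 p = x3 (fst p) (snd p) 1"

text \<open>A common format, with arbitrary sets of cells and nodes, for \<open>normal\<close>, for
  normalized equiangular sets and for the unions in the theorem.\<close>

definition assembly :: "(6 \<times> 6 \<times> 6) set \<Rightarrow> (block \<Rightarrow> (6 set \<times> int) set) \<Rightarrow> vec26 set" where
  "assembly T C = cell ` T \<union> (\<Union>b. node b ` C b)"

text \<open>One representative of each pair \<open>{u, rho - u}\<close> of admissible vectors of the lattice.\<close>

definition normal :: "vec26 set" where
  "normal = assembly UNIV (\<lambda>_. triples)"

lemma normal_cases:
  assumes "u \<in> normal"
  obtains (cell) p where "u = cell p" | (node) b p where "p \<in> triples" "u = node b p"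
  using assms unfolding normal_def assembly_def by blast

lemma cell_normal: "cell p \<in> normal"
  by (auto simp: normal_def assembly_def)

lemma node_normal: "p \<in> triples \<Longrightarrow> node b p \<in> normal"
  unfolding normal_def assembly_def by blast

section \<open>Every admissible vector is a representative up to switching\<close>

lemma inner_rho: "(v1, v2, v3, v4, v5, v6, v7) \<bullet> rho = v7 $ 1 - v7 $ 2"
  by (simp add: rho_def inner_vec_def alpha1_def sum_2)

lemma rho_minus_node:
  assumes "card I = 3"
  shows "rho - x1 I e f = x1 (- I) (- e) (- f)" "rho - x2 I e f = x2 (- I) (- e) (- f)"
    "rho - x3 I e f = x3 (- I) (- e) (- f)"
proof -
  have "card (- I) = 3"
    using assms by (simp add: card_Compl)
  then show "rho - x1 I e f = x1 (- I) (- e) (- f)" "rho - x2 I e f = x2 (- I) (- e) (- f)"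
    "rho - x3 I e f = x3 (- I) (- e) (- f)"
    using assms
    by (simp_all add: rho_def x1_def x2_def x3_def scaleR_2 alpha_set_eq_glue glue_Compl)
qed

lemma switching_root_cases:
  assumes "u \<in> lattice_L" and "u \<bullet> rho = 1" and "u \<bullet> u = 3"
  shows "u \<in> normal \<or> rho - u \<in> normal"
proof -
  obtain a0 a1 a2 a3 v1 v2 v3 v4 v5 v6 v7 where
    u: "u = (v1, v2, v3, v4, v5, v6, v7)" and
    coset: "in_coset (a0 + 3 * a1) v1" "in_coset (a0 + 3 * a2) v2" "in_coset (a0 + 3 * a3) v3"
      "in_coset (a2 + a3) v4" "in_coset (a1 + a3) v5" "in_coset (a1 + a2) v6"
      "in_coset (a0 + a1 + a2 + a3) v7"
    using lattice_L_cosets[OF assms(1)] by metis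
  \<comment> \<open>The product with \<open>rho\<close> fixes the difference of the two last
    coordinates and the coset condition fixes their sum.\<close>
  have "v7 $ 1 - v7 $ 2 = 1" "v7 $ 1 + v7 $ 2 = 0"
    using assms(2) coset(7) by (simp_all add: u inner_rho in_coset_def sum_2)
  then have v7_coords: "v7 $ 1 = 1 / 2" "v7 $ 2 = - (1 / 2)"
    by simp_all
  then have v7: "v7 = alpha1"
    by (simp add: alpha1_def vec_eq_iff forall_2)
  \<comment> \<open>An even index would make the coordinates of \<open>v7\<close> integers, but they
    are 1/2 and -1/2.\<close>
  have odd: "odd (a0 + a1 + a2 + a3)"
  proof
    assume "even (a0 + a1 + a2 + a3)"
    then obtain c where "a0 + a1 + a2 + a3 = 2 * c" ..
    then have "v7 $ 1 - real_of_int (2 * c) / real CARD(2) \<in> \<int>"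
      using coset(7) unfolding in_coset_def by metis
    then have "1 / 2 - real_of_int c \<in> \<int>"
      by (simp add: v7_coords)
    then obtain d where "1 / 2 - real_of_int c = of_int d"
      by (auto elim: Ints_cases)
    then have "real_of_int (2 * c + 2 * d) = of_int 1"
      by simp
    then have "2 * c + 2 * d = 1"
      by (simp only: of_int_eq_iff)
    then show False by presburger
  qed
  define k1 k2 k3 where k: "k1 = (a0 + 3 * a1) mod 6" "k2 = (a0 + 3 * a2) mod 6" "k3 = (a0 + 3 * a3) mod 6"
  define k4 k5 k6 where k': "k4 = (a2 + a3) mod 2" "k5 = (a1 + a3) mod 2" "k6 = (a1 + a2) mod 2"
  have ge: "v1 \<bullet> v1 \<ge> of_int (k1 * (6 - k1)) / 6" "v2 \<bullet> v2 \<ge> of_int (k2 * (6 - k2)) / 6"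
    "v3 \<bullet> v3 \<ge> of_int (k3 * (6 - k3)) / 6" "v4 \<bullet> v4 \<ge> of_int (k4 * (2 - k4)) / 2"
    "v5 \<bullet> v5 \<ge> of_int (k5 * (2 - k5)) / 2" "v6 \<bullet> v6 \<ge> of_int (k6 * (2 - k6)) / 2"
    using coset(1-6)[THEN coset_norm_ge] by (simp_all add: k k')
  have "v1 \<bullet> v1 + v2 \<bullet> v2 + v3 \<bullet> v3 + v4 \<bullet> v4 + v5 \<bullet> v5 + v6 \<bullet> v6 + 1 / 2 = 3"
    using assms(3) by (simp add: u v7 inner_glue alpha1_eq_glue)
  note norm = this
  have "real_of_int (k1 * (6 - k1) + k2 * (6 - k2) + k3 * (6 - k3) +
      3 * (k4 * (2 - k4)) + 3 * (k5 * (2 - k5)) + 3 * (k6 * (2 - k6))) \<le> of_int 15"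
    using ge norm by simp
  then have "k1 * (6 - k1) + k2 * (6 - k2) + k3 * (6 - k3) +
      3 * (k4 * (2 - k4)) + 3 * (k5 * (2 - k5)) + 3 * (k6 * (2 - k6)) \<le> 15"
    by (simp only: of_int_le_iff)
  from min_norm_cosets[OF odd this[unfolded k k']]
  have cases: "(k1, k2, k3, k4, k5, k6) \<in>
    {(1, 1, 1, 0, 0, 0), (5, 5, 5, 0, 0, 0), (3, 0, 0, 0, 1, 1), (0, 3, 0, 1, 0, 1), (0, 0, 3, 1, 1, 0)}"
    by (simp only: k k')
  \<comment> \<open>In each of the five cases the minima already add up to the available norm 5/2,
    so every block attains its minimum and is a glue vector.\<close>
  have "real_of_int (k1 * (6 - k1)) / 6 + real_of_int (k2 * (6 - k2)) / 6 + real_of_int (k3 * (6 - k3)) / 6 +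
      real_of_int (k4 * (2 - k4)) / 2 + real_of_int (k5 * (2 - k5)) / 2 + real_of_int (k6 * (2 - k6)) / 2 = 5 / 2"
    using cases by (elim insertE emptyE) simp_all
  then have eq: "v1 \<bullet> v1 = of_int (k1 * (6 - k1)) / 6" "v2 \<bullet> v2 = of_int (k2 * (6 - k2)) / 6"
    "v3 \<bullet> v3 = of_int (k3 * (6 - k3)) / 6" "v4 \<bullet> v4 = of_int (k4 * (2 - k4)) / 2"
    "v5 \<bullet> v5 = of_int (k5 * (2 - k5)) / 2" "v6 \<bullet> v6 = of_int (k6 * (2 - k6)) / 2"
    using ge norm by linarith+
  have ex6: "\<exists>I. card I = nat (k mod 6) \<and> v = glue I"
    if "in_coset k v" "v \<bullet> v = of_int (k mod 6 * (6 - k mod 6)) / 6" for k and v :: "real^6"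
    using coset_norm_eq[OF that(1)] that(2) by simp
  have ex2: "\<exists>I. card I = nat (k mod 2) \<and> v = glue I"
    if "in_coset k v" "v \<bullet> v = of_int (k mod 2 * (2 - k mod 2)) / 2" for k and v :: "real^2"
    using coset_norm_eq[OF that(1)] that(2) by simp
  obtain I1 where I1: "card I1 = nat k1" "v1 = glue I1"
    using ex6[OF coset(1)] eq(1) unfolding k k' by blast
  obtain I2 where I2: "card I2 = nat k2" "v2 = glue I2"
    using ex6[OF coset(2)] eq(2) unfolding k k' by blast
  obtain I3 where I3: "card I3 = nat k3" "v3 = glue I3"
    using ex6[OF coset(3)] eq(3) unfolding k k' by blast
  obtain I4 where I4: "card I4 = nat k4" "v4 = glue I4"
    using ex2[OF coset(4)] eq(4) unfolding k k' by blast
  obtain I5 where I5: "card I5 = nat k5" "v5 = glue I5"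
    using ex2[OF coset(5)] eq(5) unfolding k k' by blast
  obtain I6 where I6: "card I6 = nat k6" "v6 = glue I6"
    using ex2[OF coset(6)] eq(6) unfolding k k' by blast
  note I = I1(1) I2(1) I3(1) I4(1) I5(1) I6(1) and v = I1(2) I2(2) I3(2) I4(2) I5(2) I6(2)
  have sign: "\<exists>e\<in>{1, - 1}. glue K = of_int e *\<^sub>R alpha1" if K: "card K = 1" for K :: "2 set"
  proof -
    obtain z where "K = {z}"
      using card_1_singletonE[OF K] .
    then show ?thesis
      using minus_alpha1_eq_glue alpha1_eq_glue exhaust_2[of z] by force
  qed
  have normal: "x \<in> normal \<or> rho - x \<in> normal"
    if "x \<in> {x1 I e f, x2 I e f, x3 I e f}" "card I = 3" "e \<in> {1, - 1}" "f \<in> {1, - 1}" for x I e f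
  proof -
    have "(I, e) \<in> triples" "(- I, - e) \<in> triples"
      using that by (auto simp: card_Compl)
    note this[THEN node_normal]
    from this(1)[of B1] this(1)[of B2] this(1)[of B3] this(2)[of B1] this(2)[of B2] this(2)[of B3]
    have pos: "{x1 I e 1, x2 I e 1, x3 I e 1} \<subseteq> normal"
      "{x1 (- I) (- e) 1, x2 (- I) (- e) 1, x3 (- I) (- e) 1} \<subseteq> normal"
      by simp_all
    show ?thesis
    proof (cases "f = 1")
      case True
      then show ?thesis using pos that(1) by auto
    next
      case False
      then have "f = - 1" using that(4) by simp
      then have "rho - x \<in> {x1 (- I) (- e) 1, x2 (- I) (- e) 1, x3 (- I) (- e) 1}"
        using that(1) rho_minus_node[OF that(2), of e "- 1"] by auto
      then show ?thesis using pos(2) by blast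
    qed
  qed
  from cases consider
    "card I1 = 1" "card I2 = 1" "card I3 = 1" "card I4 = 0" "card I5 = 0" "card I6 = 0"
    | "card I1 = 5" "card I2 = 5" "card I3 = 5" "card I4 = 0" "card I5 = 0" "card I6 = 0"
    | "card I1 = 3" "card I2 = 0" "card I3 = 0" "card I4 = 0" "card I5 = 1" "card I6 = 1"
    | "card I1 = 0" "card I2 = 3" "card I3 = 0" "card I4 = 1" "card I5 = 0" "card I6 = 1"
    | "card I1 = 0" "card I2 = 0" "card I3 = 3" "card I4 = 1" "card I5 = 1" "card I6 = 0"
    unfolding I by (elim insertE emptyE) (simp_all add: prod_eq_iff)
  then show ?thesis
  proof cases
    case 1
    then obtain i j l where "I1 = {i}" "I2 = {j}" "I3 = {l}"
      by (metis card_1_singletonE)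
    with 1 have "u = cell (i, j, l)"
      by (simp add: u v v7 cell_def x0_def alpha5_at_eq_glue)
    then show ?thesis
      by (simp add: cell_normal)
  next
    case 2
    \<comment> \<open>A set of five indices is the complement of a singleton, so here it is the
      switched vector that is a cell.\<close>
    then have "card (- I1) = 1" "card (- I2) = 1" "card (- I3) = 1"
      by (simp_all add: card_Compl)
    then obtain i j l where "- I1 = {i}" "- I2 = {j}" "- I3 = {l}"
      by (metis card_1_singletonE)
    then have "I1 = - {i}" "I2 = - {j}" "I3 = - {l}"
      by blast+
    with 2 have "rho - u = cell (i, j, l)"
      by (simp add: u v v7 cell_def x0_def alpha5_at_eq_glue glue_Compl rho_def scaleR_2)
    then show ?thesis
      by (simp add: cell_normal)
  next
    case 3
    obtain e where e: "e \<in> {1, - 1}" "v5 = of_int e *\<^sub>R alpha1"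
      using sign[OF 3(5)] unfolding v by blast
    obtain f where f: "f \<in> {1, - 1}" "v6 = of_int f *\<^sub>R alpha1"
      using sign[OF 3(6)] unfolding v by blast
    have "u = x1 I1 e f"
      using 3 by (simp add: u e(2) f(2) v(1-4) v7 x1_def alpha_set_eq_glue)
    then show ?thesis
      using normal[of u I1 e f] e(1) f(1) 3 by blast
  next
    case 4
    \<comment> \<open>In \<open>x2\<close> the first sign belongs to the sixth block and the second
      sign to the fourth.\<close>
    obtain e where e: "e \<in> {1, - 1}" "v6 = of_int e *\<^sub>R alpha1"
      using sign[OF 4(6)] unfolding v by blast
    obtain f where f: "f \<in> {1, - 1}" "v4 = of_int f *\<^sub>R alpha1"
      using sign[OF 4(4)] unfolding v by blast
    have "u = x2 I2 e f"
      using 4 by (simp add: u e(2) f(2) v(1,2,3,5) v7 x2_def alpha_set_eq_glue)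
    then show ?thesis
      using normal[of u I2 e f] e(1) f(1) 4 by blast
  next
    case 5
    obtain e where e: "e \<in> {1, - 1}" "v4 = of_int e *\<^sub>R alpha1"
      using sign[OF 5(4)] unfolding v by blast
    obtain f where f: "f \<in> {1, - 1}" "v5 = of_int f *\<^sub>R alpha1"
      using sign[OF 5(5)] unfolding v by blast
    have "u = x3 I3 e f"
      using 5 by (simp add: u e(2) f(2) v(1,2,3,6) v7 x3_def alpha_set_eq_glue)
    then show ?thesis
      using normal[of u I3 e f] e(1) f(1) 5 by blast
  qed
qed

text \<open>Each representative lies blockwise in the same cosets as one of the \<open>beta\<close>
  vectors, so the two differ by an element of \<open>Lambda\<close>. Signs do not matter, as
  \<open>- alpha1\<close> lies in the coset of \<open>alpha1\<close>.\<close>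

lemma normal_subset_lattice_L: "normal \<subseteq> lattice_L"
proof -
  have in_L: "b + w \<in> lattice_L" if "b \<in> {beta0, beta1, beta2, beta3}" "w \<in> Lambda" for b w
    using that unfolding lattice_L_def
    by (intro group_closure_add group_closure.base) auto
  have A: "v - w \<in> lattice_A" if "in_coset k v" "in_coset k w" for k and v w :: "real^'n"
    using in_coset_diff[OF that] by (simp add: in_coset_0)
  have zero: "0 \<in> (lattice_A :: (real^'n) set)"
    by (simp add: lattice_A_def)
  have glue1: "in_coset 1 (glue {i})" for i :: "'n::finite"
    using in_coset_glue[of "{i}"] by simp
  have sign: "in_coset 1 (of_int e *\<^sub>R alpha1)" if "e \<in> {1, - 1}" for e
    by (simp only: sign_alpha1_eq_glue[OF that] glue1)
  have "x0 i j k - beta0 \<in> Lambda" for i j k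
    by (simp add: x0_def beta0_def Lambda_def zero zero_prod_def A[OF glue1 glue1] alpha5_at_eq_glue alpha5_eq_glue)
  then have "x0 i j k \<in> lattice_L" for i j k
    using in_L[of beta0 "x0 i j k - beta0"] by simp
  then have "cell p \<in> lattice_L" for p
    by (simp add: cell_def split: prod.split)
  moreover have "x1 I e 1 \<in> lattice_L \<and> x2 I e 1 \<in> lattice_L \<and> x3 I e 1 \<in> lattice_L"
    if "(I, e) \<in> triples" for I e
  proof -
    have "card I = 3" and e: "e \<in> {1, - 1}"
      using that by auto
    then have I: "in_coset 3 (alpha_set I)"
      using in_coset_glue[of I] by (simp add: alpha_set_eq_glue)
    have "{x1 I e 1 - beta1, x2 I e 1 - beta2, x3 I e 1 - beta3} \<subseteq> Lambda"
      by (simp add: x1_def beta1_def x2_def beta2_def x3_def beta3_def Lambda_def zero zero_prod_def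
          A[OF I in_coset_alpha(2)] A[OF sign[OF e] in_coset_alpha(3)])
    then show ?thesis
      using in_L[of beta1 "x1 I e 1 - beta1"] in_L[of beta2 "x2 I e 1 - beta2"]
        in_L[of beta3 "x3 I e 1 - beta3"] by simp
  qed
  then have "node b q \<in> lattice_L" if "q \<in> triples" for b q
    using that by (cases q; cases b) auto
  ultimately show ?thesis
    by (auto elim: normal_cases)
qed

section \<open>Inner products of representatives\<close>

definition agreements :: "6 \<times> 6 \<times> 6 \<Rightarrow> 6 \<times> 6 \<times> 6 \<Rightarrow> nat" where
  "agreements = (\<lambda>(i, j, k) (i', j', k'). of_bool (i = i') + of_bool (j = j') + of_bool (k = k'))"

lemma agreements_eq_3_iff: "agreements p q = 3 \<longleftrightarrow> p = q"
  by (auto simp: agreements_def of_bool_def split: if_splits prod.splits)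

text \<open>Each of the three large blocks contributes an indicator minus 1/6, and the 1/2 from the
  last block cancels these constants.\<close>

lemma inner_cell_cell: "cell p \<bullet> cell q = real (agreements p q)"
proof -
  have "card ({i} \<inter> {j}) = of_bool (i = j)" for i j :: 6
    by simp
  then show ?thesis
    by (cases p; cases q)
      (simp add: cell_def x0_def agreements_def alpha5_at_eq_glue alpha1_eq_glue inner_glue)
qed

text \<open>Only one large block is shared; it contributes an indicator minus 1/2, and the last
  block adds 1/2.\<close>

lemma inner_cell_node:
  assumes "q \<in> triples"
  shows "cell p \<bullet> node b q \<in> {0, 1}"
proof -
  have "card ({i} \<inter> J) \<in> {0, 1}" for i and J :: "6 set"
    by (cases "i \<in> J") auto
  then show ?thesis
    using assms
    by (cases p; cases q; cases b; force simp: cell_def x0_def x1_def x2_def x3_def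
        alpha5_at_eq_glue alpha_set_eq_glue inner_glue alpha1_eq_glue)
qed

text \<open>Two different families share one two-dimensional block besides the last; these
  contribute 1/2 or -1/2, and 1/2.\<close>

lemma inner_node_node:
  assumes "p \<in> triples" and "q \<in> triples" and "b \<noteq> c"
  shows "node b p \<bullet> node c q \<in> {0, 1}"
  using assms
  by (cases p; cases q; cases b; cases c;
      auto simp: x1_def x2_def x3_def alpha1_eq_glue inner_glue)

text \<open>The large block contributes the intersection number minus 3/2. The fixed second sign and
  the last block add 1, and the first signs add 1/2 or -1/2.\<close>

lemma inner_node_self:
  assumes "p \<in> triples" and "q \<in> triples"
  shows "node b p \<bullet> node b q = real (card (fst p \<inter> fst q)) - (if snd p = snd q then 0 else 1)"
  using assms
  by (cases p; cases q; cases b;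
      auto simp: x1_def x2_def x3_def alpha1_eq_glue alpha_set_eq_glue inner_glue)

lemma inner_node_self_edge:
  assumes "p \<in> triples" and "q \<in> triples"
  shows "node b p \<bullet> node b q \<in> {0, 1} \<longleftrightarrow> (p, q) \<in> edges clique_graph"
  using assms edges_clique_graph[of "fst p" "snd p" "fst q" "snd q"]
  by (auto simp: inner_node_self[OF assms])

lemma inner_node_self_eq_3_iff:
  assumes "p \<in> triples" and "q \<in> triples"
  shows "node b p \<bullet> node b q = 3 \<longleftrightarrow> p = q"
  using assms card_inter_le_3[of "fst p" "fst q"] card_inter_eq_3_iff[of "fst p" "fst q"]
  unfolding inner_node_self[OF assms] by (auto simp: prod_eq_iff mem_Times_iff)

lemma normal_inner_rho:
  assumes "u \<in> normal"
  shows "u \<bullet> rho = 1"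
  using assms
proof (cases rule: normal_cases)
  case (cell p)
  then show ?thesis
    by (cases p) (simp add: cell_def x0_def inner_rho alpha1_def)
next
  case (node b p)
  then show ?thesis
    by (cases b) (simp_all add: x1_def x2_def x3_def inner_rho alpha1_def)
qed

lemma normal_inner_self:
  assumes "u \<in> normal"
  shows "u \<bullet> u = 3"
  using assms
proof (cases rule: normal_cases)
  case (cell p)
  then show ?thesis
    using agreements_eq_3_iff[of p p] by (simp add: inner_cell_cell)
next
  case (node b p)
  then show ?thesis
    using inner_node_self_eq_3_iff by blast
qed

text \<open>Isolates the only pairs whose compatibility is in question: two cells, or two nodes of
  one family.\<close>

lemma inner_normal_cases:
  assumes "u \<in> normal" and "v \<in> normal"
  obtains (cells) p q where "u = cell p" "v = cell q"
  | (nodes) b p q where "p \<in> triples" "q \<in> triples" "u = node b p" "v = node b q"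
  | (mixed) "u \<bullet> v \<in> {0, 1}"
  using assms(1)
proof (cases rule: normal_cases)
  case u: (cell p)
  show thesis
    using assms(2)
  proof (cases rule: normal_cases)
    case (cell q)
    with u show thesis by (rule cells)
  next
    case (node c q)
    with u show thesis using mixed inner_cell_node by blast
  qed
next
  case u: (node b p)
  show thesis
    using assms(2)
  proof (cases rule: normal_cases)
    case (cell q)
    with u show thesis using mixed inner_cell_node[of p q b] by (simp add: inner_commute)
  next
    case (node c q)
    with u show thesis
      using mixed nodes inner_node_node[of p q b c] by (cases "b = c") blast+
  qed
qed

lemma normal_not_switched:
  assumes "u \<in> normal"
  shows "rho - u \<notin> normal"
proof
  assume "rho - u \<in> normal"
  with assms have "- 1 \<le> u \<bullet> (rho - u)"
  proof (cases rule: inner_normal_cases)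
    case (cells p q)
    then show ?thesis by (simp only: inner_cell_cell)
  next
    case (nodes b p q)
    then show ?thesis by (simp only: inner_node_self) simp
  next
    case mixed
    then show ?thesis by auto
  qed
  then show False
    using normal_inner_rho[OF assms] normal_inner_self[OF assms] by (simp add: inner_diff_right)
qed

section \<open>Recovering the cells and nodes from an assembly\<close>

lemma cell_eq_iff: "cell p = cell q \<longleftrightarrow> p = q"
proof
  assume "cell p = cell q"
  then have "cell p \<bullet> cell q = 3"
    by (simp add: normal_inner_self cell_normal)
  then show "p = q"
    by (simp add: inner_cell_cell flip: agreements_eq_3_iff)
qed simp

lemma node_neq_cell:
  assumes "q \<in> triples"
  shows "node b q \<noteq> cell p" "cell p \<noteq> node b q"
  using inner_cell_node[OF assms, of p b] normal_inner_self[OF cell_normal[of p]] by auto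

text \<open>Equal vectors have inner product 3. Different families allow only 0 and 1, and within a
  family 3 forces equal arguments.\<close>

lemma node_eq_iff:
  assumes "p \<in> triples" and "q \<in> triples"
  shows "node b p = node c q \<longleftrightarrow> b = c \<and> p = q"
proof
  assume eq: "node b p = node c q"
  then have "node b p \<bullet> node c q = 3"
    using normal_inner_self[OF node_normal[OF assms(1), of b]] by simp
  then show "b = c \<and> p = q"
    using inner_node_node[OF assms, of b c] inner_node_self_eq_3_iff[OF assms] by (cases "b = c") auto
qed simp

lemma cell_in_assembly:
  assumes "\<And>b. C b \<subseteq> triples"
  shows "cell p \<in> assembly T C \<longleftrightarrow> p \<in> T"
proof
  assume "cell p \<in> assembly T C"
  then consider q where "q \<in> T" "cell p = cell q" | c q where "q \<in> C c" "cell p = node c q"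
    unfolding assembly_def by blast
  then show "p \<in> T"
  proof cases
    case 1
    then show ?thesis by (simp add: cell_eq_iff)
  next
    case 2
    then show ?thesis using node_neq_cell assms by blast
  qed
qed (simp add: assembly_def)

lemma node_in_assembly:
  assumes "\<And>b. C b \<subseteq> triples" and "p \<in> triples"
  shows "node b p \<in> assembly T C \<longleftrightarrow> p \<in> C b"
proof
  assume "node b p \<in> assembly T C"
  then consider q where "node b p = cell q" | c q where "q \<in> C c" "node b p = node c q"
    unfolding assembly_def by blast
  then show "p \<in> C b"
  proof cases
    case 1
    then show ?thesis using node_neq_cell assms(2) by blast
  next
    case 2
    then have "q \<in> triples"
      using assms(1) by blast
    with 2 show ?thesis
      by (simp only: node_eq_iff[OF assms(2)])
  qed
qed (auto simp: assembly_def)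

lemma assembly_inject:
  assumes "\<And>b. C b \<subseteq> triples" and "\<And>b. C' b \<subseteq> triples" and eq: "assembly T C = assembly T' C'"
  shows "T = T'" "C b = C' b"
proof -
  show "T = T'"
  proof (rule set_eqI)
    fix p
    have "p \<in> T \<longleftrightarrow> cell p \<in> assembly T C"
      by (simp only: cell_in_assembly[OF assms(1)])
    also have "\<dots> \<longleftrightarrow> p \<in> T'"
      by (simp only: eq cell_in_assembly[OF assms(2)])
    finally show "p \<in> T \<longleftrightarrow> p \<in> T'" .
  qed
  have "p \<in> C b \<longleftrightarrow> p \<in> C' b" if "p \<in> triples" for p
  proof -
    have "p \<in> C b \<longleftrightarrow> node b p \<in> assembly T C"
      by (simp only: node_in_assembly[OF assms(1) that])
    also have "\<dots> \<longleftrightarrow> p \<in> C' b"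
      by (simp only: eq node_in_assembly[OF assms(2) that])
    finally show ?thesis .
  qed
  then show "C b = C' b"
    using assms(1)[of b] assms(2)[of b] by blast
qed

lemma finite_subset_triples: "C \<subseteq> triples \<Longrightarrow> finite C"
  by (rule finite_subset) auto

lemma card_assembly:
  assumes "\<And>b. C b \<subseteq> triples"
  shows "card (assembly T C) = card T + (card (C B1) + card (C B2) + card (C B3))"
proof -
  have fin: "finite T" "finite (C b)" for b
    using assms by (simp_all add: finite_subset_triples)
  have node_eq: "node b p = node c q \<longleftrightarrow> b = c \<and> p = q" if "p \<in> C b" "q \<in> C c" for b c p q
    using subsetD[OF assms that(1)] subsetD[OF assms that(2)] by (rule node_eq_iff)
  then have "inj_on (node b) (C b)" for b
    by (simp add: inj_on_def)
  then have "card (node b ` C b) = card (C b)" for b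
    by (rule card_image)
  moreover have "card (\<Union>b. node b ` C b) = (\<Sum>b\<in>UNIV. card (node b ` C b))"
  proof (rule card_UN_disjoint)
    show "finite (UNIV :: block set)"
      by (simp add: UNIV_block)
    show "\<forall>b\<in>UNIV. finite (node b ` C b)"
      using fin by simp
    show "\<forall>b\<in>UNIV. \<forall>c\<in>UNIV. b \<noteq> c \<longrightarrow> node b ` C b \<inter> node c ` C c = {}"
      using node_eq by blast
  qed
  moreover have "card (assembly T C) = card (cell ` T) + card (\<Union>b. node b ` C b)"
    unfolding assembly_def
  proof (rule card_Un_disjoint)
    show "finite (cell ` T)" "finite (\<Union>b. node b ` C b)"
      using fin by (simp_all add: UNIV_block)
    show "cell ` T \<inter> (\<Union>b. node b ` C b) = {}"
      using node_neq_cell(2)[OF subsetD[OF assms]] by blast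
  qed
  moreover have "card (cell ` T) = card T"
    by (intro card_image inj_onI) (simp add: cell_eq_iff)
  ultimately show ?thesis
    by (simp add: UNIV_block)
qed

text \<open>A partial Latin square as a set of triples (row, column, symbol), with the three roles
  treated symmetrically.\<close>

definition partial_latin :: "(6 \<times> 6 \<times> 6) set \<Rightarrow> bool" where
  "partial_latin T \<longleftrightarrow> (\<forall>p\<in>T. \<forall>q\<in>T. p \<noteq> q \<longrightarrow> agreements p q \<le> 1)"

lemma partial_latinD:
  "partial_latin T \<Longrightarrow> p \<in> T \<Longrightarrow> q \<in> T \<Longrightarrow> p \<noteq> q \<Longrightarrow> agreements p q \<le> 1"
  by (simp add: partial_latin_def del: split_paired_All)

text \<open>Norms and products with \<open>rho\<close> are automatic for representatives, and mixed
  pairs are always compatible. Pairs of cells give the Latin condition, and pairs of nodes in one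
  family give the edges of \<open>clique_graph\<close>.\<close>

lemma affine_equiangular_assembly:
  assumes "\<And>b. C b \<subseteq> triples"
  shows "affine_equiangular3 rho (assembly T C) \<longleftrightarrow>
    partial_latin T \<and> (\<forall>b. clique clique_graph (C b))" (is "?affine \<longleftrightarrow> ?parts")
proof
  have agree: "cell p \<bullet> cell q \<in> {0, 1} \<longleftrightarrow> agreements p q \<le> 1" for p q
    unfolding inner_cell_cell by auto
  have C: "p \<in> C b \<Longrightarrow> p \<in> triples" for b p
    using assms by blast
  show ?parts if affine: ?affine
  proof -
    have ip: "u \<bullet> v \<in> {0, 1}" if "u \<in> assembly T C" "v \<in> assembly T C" "u \<noteq> v" for u v
      using affine that unfolding affine_equiangular3_def by blast
    have "agreements p q \<le> 1" if pq: "p \<in> T" "q \<in> T" "p \<noteq> q" for p q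
    proof -
      have "cell p \<in> assembly T C" "cell q \<in> assembly T C" "cell p \<noteq> cell q"
        using pq by (simp_all add: assembly_def cell_eq_iff)
      then show ?thesis
        using ip agree by blast
    qed
    then have "partial_latin T"
      by (simp add: partial_latin_def)
    moreover have edge: "(p, q) \<in> edges clique_graph" if pq: "p \<in> C b" "q \<in> C b" "p \<noteq> q" for p q b
    proof -
      have "node b p \<in> assembly T C" "node b q \<in> assembly T C"
        using pq(1,2) unfolding assembly_def by blast+
      moreover have "node b p \<noteq> node b q"
        using pq(3) by (simp add: node_eq_iff[OF C[OF pq(1)] C[OF pq(2)]])
      ultimately have "node b p \<bullet> node b q \<in> {0, 1}"
        by (rule ip)
      then show ?thesis
        by (rule inner_node_self_edge[OF C[OF pq(1)] C[OF pq(2)], THEN iffD1])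
    qed
    have "clique clique_graph (C b)" for b
      unfolding clique_def vertices_clique_graph using assms[of b] edge[of _ b] by simp
    ultimately show ?thesis
      by simp
  qed
  show ?affine if parts: ?parts
    unfolding affine_equiangular3_def
  proof (intro conjI ballI impI)
    have normal: "u \<in> normal" if "u \<in> assembly T C" for u
      using that C unfolding normal_def assembly_def by blast
    fix u assume u: "u \<in> assembly T C"
    show "u \<bullet> rho = 1" "u \<bullet> u = 3"
      using normal[OF u] by (simp_all add: normal_inner_rho normal_inner_self)
    fix v assume v: "v \<in> assembly T C" and "u \<noteq> v"
    from normal[OF u] normal[OF v] show "u \<bullet> v \<in> {0, 1}"
    proof (cases rule: inner_normal_cases)
      case (cells p q)
      then have "p \<in> T" "q \<in> T" "p \<noteq> q"
        using u v \<open>u \<noteq> v\<close> by (auto simp: cell_in_assembly assms)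
      then show ?thesis
        using parts agree unfolding cells partial_latin_def by blast
    next
      case (nodes b p q)
      then have "p \<in> C b" "q \<in> C b" "p \<noteq> q"
        using u v \<open>u \<noteq> v\<close> by (auto simp: node_in_assembly assms simp del: mem_Sigma_iff)
      then show ?thesis
        using parts inner_node_self_edge[OF nodes(1,2)] unfolding nodes(3,4) clique_def by blast
    next
      case mixed
      then show ?thesis .
    qed
  qed
qed

section \<open>Maximum affine equiangular sets\<close>

text \<open>Switching one of two vectors turns their inner product t into 1 - t, and switching both
  preserves it, as \<open>rho\<close> has norm 2. Hence moving every vector into
  \<open>normal\<close> keeps the products in {0, 1}.\<close>

lemma switching_to_normal:
  assumes "affine_equiangular3_in lattice_L rho \<omega>"
  obtains T C where "partial_latin T" "\<And>b. C b \<subseteq> triples" "\<And>b. clique clique_graph (C b)"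
    "switching_equivalent rho \<omega> (assembly T C)"
proof -
  have \<omega>: "u \<in> lattice_L" "u \<bullet> rho = 1" "u \<bullet> u = 3" if "u \<in> \<omega>" for u
    using assms that by (auto simp: affine_equiangular3_in_def affine_equiangular3_def)
  have ip: "u \<bullet> v \<in> {0, 1}" if "u \<in> \<omega>" "v \<in> \<omega>" "u \<noteq> v" for u v
    using assms that unfolding affine_equiangular3_in_def affine_equiangular3_def by blast
  define g where "g u = (if u \<in> normal then u else rho - u)" for u
  have g: "g u \<in> {u, rho - u}" for u
    by (simp add: g_def)
  have g_normal: "g u \<in> normal" if "u \<in> \<omega>" for u
    using switching_root_cases[OF \<omega>[OF that]] by (auto simp: g_def)
  have rho: "rho \<bullet> rho = 2"
    by (simp add: rho_def alpha1_eq_glue inner_glue)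
  have g_ip: "g u \<bullet> g v \<in> {0, 1}" if "u \<in> \<omega>" "v \<in> \<omega>" "u \<noteq> v" for u v
  proof -
    have "rho \<bullet> v = 1"
      using \<omega>(2)[OF that(2)] by (simp add: inner_commute)
    then have "g u \<bullet> g v \<in> {u \<bullet> v, 1 - u \<bullet> v}"
      using \<omega>(2)[OF that(1)] rho by (simp add: g_def inner_diff_left inner_diff_right)
    then show ?thesis
      using ip[OF that] by auto
  qed
  have g_self: "g u \<bullet> g u = 3" if "u \<in> \<omega>" for u
    using g_normal[OF that] by (rule normal_inner_self)
  \<comment> \<open>Two vectors with the same image would give images whose inner product is 3,
    outside {0, 1}.\<close>
  have "inj_on g \<omega>"
  proof (rule inj_onI, rule ccontr)
    fix u v assume uv: "u \<in> \<omega>" "v \<in> \<omega>" "g u = g v" "u \<noteq> v"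
    then show False
      using g_ip[OF uv(1,2,4)] g_self[OF uv(1)] by simp
  qed
  then have bij: "bij_betw g \<omega> (g ` \<omega>)"
    by (rule inj_on_imp_bij_betw)
  define T where "T = {p. cell p \<in> g ` \<omega>}"
  define C where "C b = {p \<in> triples. node b p \<in> g ` \<omega>}" for b
  have C: "C b \<subseteq> triples" for b
    by (auto simp: C_def)
  have eq: "g ` \<omega> = assembly T C"
  proof
    show "g ` \<omega> \<subseteq> assembly T C"
    proof
      fix x assume x: "x \<in> g ` \<omega>"
      then have "x \<in> normal" using g_normal by blast
      then show "x \<in> assembly T C"
      proof (cases rule: normal_cases)
        case (cell p)
        with x have "p \<in> T" by (simp add: T_def)
        then show ?thesis unfolding cell assembly_def by blast
      next
        case (node b p)
        with x have "p \<in> C b" by (simp add: C_def)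
        then show ?thesis unfolding node assembly_def by blast
      qed
    qed
  qed (auto simp: assembly_def T_def C_def)
  have "affine_equiangular3 rho (g ` \<omega>)"
    unfolding affine_equiangular3_def using g_ip g_self g_normal normal_inner_rho by blast
  then have "partial_latin T \<and> (\<forall>b. clique clique_graph (C b))"
    unfolding eq by (rule affine_equiangular_assembly[THEN iffD1, OF C])
  moreover have "switching_equivalent rho \<omega> (assembly T C)"
    unfolding switching_equivalent_def eq[symmetric] using bij g by blast
  ultimately show thesis
    using C by (intro that) simp_all
qed

text \<open>At most one of \<open>u\<close> and \<open>rho - u\<close> is a representative, so both
  switching maps are forced to agree on \<open>\<omega>\<close>.\<close>

lemma switching_equivalent_normal_unique:
  assumes "switching_equivalent rho \<omega> X" and "switching_equivalent rho \<omega> Y"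
    and "X \<subseteq> normal" and "Y \<subseteq> normal"
  shows "X = Y"
proof -
  obtain g where g: "bij_betw g \<omega> X" "\<forall>u\<in>\<omega>. g u \<in> {u, rho - u}"
    using assms(1) unfolding switching_equivalent_def by blast
  obtain h where h: "bij_betw h \<omega> Y" "\<forall>u\<in>\<omega>. h u \<in> {u, rho - u}"
    using assms(2) unfolding switching_equivalent_def by blast
  have "g u = h u" if "u \<in> \<omega>" for u
  proof -
    have "g u \<in> normal" "h u \<in> normal"
      using that g(1) h(1) assms(3,4) bij_betwE by blast+
    then show ?thesis
      using that g(2) h(2) normal_not_switched[of u] by force
  qed
  then have "g ` \<omega> = h ` \<omega>"
    by simp
  then show ?thesis
    using g(1) h(1) by (simp add: bij_betw_def)
qed

section \<open>Latin squares as partial Latin squares with 36 cells\<close>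

definition square_cells :: "(6 \<Rightarrow> 6 \<Rightarrow> 6) \<Rightarrow> (6 \<times> 6 \<times> 6) set" where
  "square_cells S = {(i, j, S i j) | i j. True}"

lemma card_square_cells: "card (square_cells S) = 36"
proof -
  have "square_cells S = range (\<lambda>(i, j). (i, j, S i j))"
    by (auto simp: square_cells_def)
  moreover have "inj (\<lambda>(i, j). (i, j, S i j))"
    by (auto intro: injI)
  ultimately show ?thesis
    by (simp add: card_image)
qed

lemma square_cells_inject: "square_cells S = square_cells S' \<Longrightarrow> S = S'"
  by (force simp: square_cells_def intro!: ext)

text \<open>Distinct cells of a square differ in row or column, so two agreements mean a repeated
  symbol in a row or column. On a finite index set, injectivity gives bijectivity.\<close>

lemma latin_square_iff: "latin_square S \<longleftrightarrow> partial_latin (square_cells S)"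
proof
  assume "latin_square S"
  then have "S i j = S i j' \<longleftrightarrow> j = j'" "S i j = S i' j \<longleftrightarrow> i = i'" for i j i' j'
    unfolding latin_square_def by (auto dest: bij_is_inj injD)
  then show "partial_latin (square_cells S)"
    by (auto simp: partial_latin_def square_cells_def agreements_def of_bool_def)
next
  assume latin: "partial_latin (square_cells S)"
  have agree: "agreements (i, j, S i j) (i', j', S i' j') \<le> 1" if "i \<noteq> i' \<or> j \<noteq> j'" for i j i' j'
  proof -
    have "(i, j, S i j) \<in> square_cells S" "(i', j', S i' j') \<in> square_cells S"
      by (auto simp: square_cells_def)
    moreover have "(i, j, S i j) \<noteq> (i', j', S i' j')"
      using that by auto
    ultimately show ?thesis
      by (rule partial_latinD[OF latin])
  qed
  have row: "j = j'" if "S i j = S i j'" for i j j'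
    using agree[of i i j j'] that by (cases "j = j'") (simp_all add: agreements_def)
  have col: "i = i'" if "S i j = S i' j" for i i' j
    using agree[of i i' j j] that by (cases "i = i'") (simp_all add: agreements_def)
  have "inj (\<lambda>j. S i j)" "inj (\<lambda>i. S i j)" for i j
    by (rule injI, erule row, rule injI, erule col)
  then show "latin_square S"
    unfolding latin_square_def by (simp add: bij_def finite_UNIV_inj_surj)
qed

text \<open>The projection to (row, column) is injective on \<open>T\<close>; with 36 cells it is
  also onto, so \<open>T\<close> is the graph of a function.\<close>

lemma partial_latin_card:
  assumes "partial_latin T"
  shows "card T \<le> 36" and "card T = 36 \<Longrightarrow> \<exists>S. T = square_cells S"
proof -
  define f :: "6 \<times> 6 \<times> 6 \<Rightarrow> 6 \<times> 6" where "f = (\<lambda>(i, j, k). (i, j))"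
  have inj: "inj_on f T"
  proof (rule inj_onI, rule ccontr)
    fix p q assume pq: "p \<in> T" "q \<in> T" "f p = f q" "p \<noteq> q"
    then have "agreements p q \<ge> 2"
      by (cases p; cases q) (simp add: f_def agreements_def)
    moreover have "agreements p q \<le> 1"
      using pq by (intro partial_latinD[OF assms])
    ultimately show False by linarith
  qed
  have "card (f ` T) \<le> card (UNIV :: (6 \<times> 6) set)"
    by (intro card_mono) auto
  then show "card T \<le> 36"
    by (simp add: card_image[OF inj])
  assume "card T = 36"
  then have "f ` T = UNIV"
    by (intro card_subset_eq) (simp_all add: card_image[OF inj])
  then have "\<exists>k. (i, j, k) \<in> T" for i j
    by (force simp: f_def image_iff dest!: equalityD2 subsetD[of _ _ "(i, j)"])
  then obtain S where S: "(i, j, S i j) \<in> T" for i j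
    by metis
  have "k = S i j" if "(i, j, k) \<in> T" for i j k
    using inj_onD[OF inj _ that S[of i j]] by (simp add: f_def)
  then have "T = square_cells S"
    using S by (auto simp: square_cells_def)
  then show "\<exists>S. T = square_cells S"
    by blast
qed

lemma omega_eq_assembly:
  "omega0 S \<union> omega1 C1 \<union> omega2 C2 \<union> omega3 C3 = assembly (square_cells S) (case_block C1 C2 C3)"
proof -
  have "omega0 S = cell ` square_cells S"
    by (auto simp: omega0_def square_cells_def cell_def image_iff) metis
  moreover have "omega1 C1 = node B1 ` C1" "omega2 C2 = node B2 ` C2" "omega3 C3 = node B3 ` C3"
    by (force simp: omega1_def omega2_def omega3_def image_iff)+
  ultimately show ?thesis
    by (simp add: assembly_def UNIV_block Un_assoc)
qed

text \<open>The bound is 36 + 7 + 7 + 7, and equality forces each of the four parts to be of maximum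
  size.\<close>

lemma affine_equiangular_card_le_57:
  assumes "affine_equiangular3_in lattice_L rho \<omega>"
  shows "finite \<omega>" and "card \<omega> \<le> 57"
    and "card \<omega> = 57 \<Longrightarrow> \<exists>S C1 C2 C3. latin_square S \<and>
      clique clique_graph C1 \<and> card C1 = 7 \<and> clique clique_graph C2 \<and> card C2 = 7 \<and>
      clique clique_graph C3 \<and> card C3 = 7 \<and>
      switching_equivalent rho \<omega> (omega0 S \<union> omega1 C1 \<union> omega2 C2 \<union> omega3 C3)"
proof -
  obtain T C where T: "partial_latin T" and C: "\<And>b. C b \<subseteq> triples" "\<And>b. clique clique_graph (C b)"
    and switch: "switching_equivalent rho \<omega> (assembly T C)"
    using switching_to_normal[OF assms] by metis
  obtain g where g: "bij_betw g \<omega> (assembly T C)"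
    using switch unfolding switching_equivalent_def by blast
  have "finite (assembly T C)"
    unfolding assembly_def using finite_subset[OF C(1)] by (auto simp: UNIV_block)
  then show "finite \<omega>"
    using bij_betw_finite[OF g] by simp
  have card: "card \<omega> = card T + (card (C B1) + card (C B2) + card (C B3))"
    using bij_betw_same_card[OF g] card_assembly[of C T, OF C(1)] by simp
  note le = partial_latin_card(1)[OF T] C(2)[THEN clique_card_le_7, of B1]
    C(2)[THEN clique_card_le_7, of B2] C(2)[THEN clique_card_le_7, of B3]
  show "card \<omega> \<le> 57"
    using card le by linarith
  assume "card \<omega> = 57"
  then have eq: "card T = 36" "card (C B1) = 7" "card (C B2) = 7" "card (C B3) = 7"
    using card le by linarith+
  obtain S where S: "T = square_cells S"
    using partial_latin_card(2)[OF T eq(1)] by blast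
  have "C = case_block (C B1) (C B2) (C B3)"
    by (rule ext) (simp split: block.split)
  then have "switching_equivalent rho \<omega> (omega0 S \<union> omega1 (C B1) \<union> omega2 (C B2) \<union> omega3 (C B3))"
    using switch unfolding S omega_eq_assembly by metis
  then show "\<exists>S C1 C2 C3. latin_square S \<and>
      clique clique_graph C1 \<and> card C1 = 7 \<and> clique clique_graph C2 \<and> card C2 = 7 \<and>
      clique clique_graph C3 \<and> card C3 = 7 \<and>
      switching_equivalent rho \<omega> (omega0 S \<union> omega1 C1 \<union> omega2 C2 \<union> omega3 C3)"
    using T S C(2) eq latin_square_iff by blast
qed

lemma affine_equiangular_card_57_exists:
  "\<exists>\<omega>. affine_equiangular3_in lattice_L rho \<omega> \<and> card \<omega> = 57"
proof -
  obtain C where C: "clique clique_graph C" "card C = 7"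
    using clique_of_card_7_exists by blast
  then have sub: "C \<subseteq> triples"
    by (simp add: clique_def vertices_clique_graph)
  \<comment> \<open>The addition table of the residues modulo 6 is a Latin square. One clique serves
    all three families, since different families never conflict.\<close>
  define S :: "6 \<Rightarrow> 6 \<Rightarrow> 6" where "S i j = i + j" for i j
  have "partial_latin (square_cells S)"
    by (auto simp: partial_latin_def square_cells_def agreements_def S_def of_bool_def)
  then have "affine_equiangular3 rho (assembly (square_cells S) (\<lambda>_. C))"
    using C(1) affine_equiangular_assembly[of "\<lambda>_. C"] sub by blast
  moreover have "assembly (square_cells S) (\<lambda>_. C) \<subseteq> normal"
    using sub unfolding normal_def assembly_def by blast
  ultimately have "affine_equiangular3_in lattice_L rho (assembly (square_cells S) (\<lambda>_. C))"
    using normal_subset_lattice_L by (simp add: affine_equiangular3_in_def)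
  moreover have "card (assembly (square_cells S) (\<lambda>_. C)) = 57"
    using card_assembly[of "\<lambda>_. C"] sub by (simp add: card_square_cells C(2))
  ultimately show ?thesis by blast
qed

text \<open>All competing sets are finite, so \<open>\<prec>\<close> compares cardinalities, and the
  bound 57 is attained.\<close>

lemma maximum_affine_equiangular_iff:
  "maximum_affine_equiangular3_in lattice_L rho \<omega> \<longleftrightarrow>
    affine_equiangular3_in lattice_L rho \<omega> \<and> card \<omega> = 57"
proof -
  have less: "X \<prec> Y \<longleftrightarrow> card X < card Y"
    if "affine_equiangular3_in lattice_L rho X" "affine_equiangular3_in lattice_L rho Y" for X Y
    using that[THEN affine_equiangular_card_le_57(1)]
    by (simp add: lepoll_iff_card_le lesspoll_def eqpoll_iff_card less_le)
  show ?thesis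
    unfolding maximum_affine_equiangular3_in_def
    using less affine_equiangular_card_57_exists affine_equiangular_card_le_57(2)
    by (metis le_neq_implies_less leD)
qed

theorem theorem6p1:
  shows "(\<exists>\<omega>. maximum_affine_equiangular3_in lattice_L rho \<omega> \<and> card \<omega> = 57) \<and>
    (\<forall>\<omega>. maximum_affine_equiangular3_in lattice_L rho \<omega> \<longrightarrow>
      (\<exists>!(S, C1, C2, C3).
        latin_square S \<and>
        clique clique_graph C1 \<and> card C1 = 7 \<and>
        clique clique_graph C2 \<and> card C2 = 7 \<and>
        clique clique_graph C3 \<and> card C3 = 7 \<and>
        switching_equivalent rho \<omega> (omega0 S \<union> omega1 C1 \<union> omega2 C2 \<union> omega3 C3)))"
proof (intro conjI allI impI)
  show "\<exists>\<omega>. maximum_affine_equiangular3_in lattice_L rho \<omega> \<and> card \<omega> = 57"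
    using affine_equiangular_card_57_exists by (simp add: maximum_affine_equiangular_iff)
  fix \<omega> assume "maximum_affine_equiangular3_in lattice_L rho \<omega>"
  then have \<omega>: "affine_equiangular3_in lattice_L rho \<omega>" "card \<omega> = 57"
    by (simp_all add: maximum_affine_equiangular_iff)
  \<comment> \<open>Both unions consist of representatives, so they coincide as sets; the square and
    the three cliques are then read off from membership.\<close>
  have unique: "S = S' \<and> C1 = C1' \<and> C2 = C2' \<and> C3 = C3'"
    if cliques: "clique clique_graph C1" "clique clique_graph C2" "clique clique_graph C3"
        "clique clique_graph C1'" "clique clique_graph C2'" "clique clique_graph C3'"
      and switch: "switching_equivalent rho \<omega> (omega0 S \<union> omega1 C1 \<union> omega2 C2 \<union> omega3 C3)"
        "switching_equivalent rho \<omega> (omega0 S' \<union> omega1 C1' \<union> omega2 C2' \<union> omega3 C3')"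
    for S S' C1 C2 C3 C1' C2' C3'
  proof -
    have sub: "case_block C1 C2 C3 b \<subseteq> triples" "case_block C1' C2' C3' b \<subseteq> triples" for b
      using cliques unfolding clique_def vertices_clique_graph by (cases b; simp)+
    then have "assembly (square_cells S) (case_block C1 C2 C3) \<subseteq> normal"
      "assembly (square_cells S') (case_block C1' C2' C3') \<subseteq> normal"
      unfolding normal_def assembly_def by blast+
    then have "assembly (square_cells S) (case_block C1 C2 C3) =
        assembly (square_cells S') (case_block C1' C2' C3')"
      using switching_equivalent_normal_unique switch unfolding omega_eq_assembly by blast
    note inject = assembly_inject[OF sub this]
    show ?thesis
      using square_cells_inject[OF inject(1)] inject(2)[of B1] inject(2)[of B2] inject(2)[of B3]
      by simp
  qed
  obtain S C1 C2 C3 where parts: "latin_square S" "clique clique_graph C1" "card C1 = 7"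
      "clique clique_graph C2" "card C2 = 7" "clique clique_graph C3" "card C3 = 7"
      "switching_equivalent rho \<omega> (omega0 S \<union> omega1 C1 \<union> omega2 C2 \<union> omega3 C3)"
    using affine_equiangular_card_le_57(3)[OF \<omega>] by blast
  show "\<exists>!(S, C1, C2, C3).
        latin_square S \<and>
        clique clique_graph C1 \<and> card C1 = 7 \<and>
        clique clique_graph C2 \<and> card C2 = 7 \<and>
        clique clique_graph C3 \<and> card C3 = 7 \<and>
        switching_equivalent rho \<omega> (omega0 S \<union> omega1 C1 \<union> omega2 C2 \<union> omega3 C3)"
    (is "\<exists>!x. ?P x")
  proof (rule ex1I[of ?P "(S, C1, C2, C3)"])
    show "?P (S, C1, C2, C3)"
      using parts by simp
    fix x assume x: "?P x"
    obtain S' C1' C2' C3' where x_eq: "x = (S', C1', C2', C3')"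
      by (cases x)
    from x have "clique clique_graph C1'" "clique clique_graph C2'" "clique clique_graph C3'"
      "switching_equivalent rho \<omega> (omega0 S' \<union> omega1 C1' \<union> omega2 C2' \<union> omega3 C3')"
      unfolding x_eq by simp_all
    from unique[OF this(1-3) parts(2,4,6) this(4) parts(8)] show "x = (S, C1, C2, C3)"
      by (simp add: x_eq)
  qed
qed

end
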